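(* Let $n\ge 1$, let $\Delta\subset\mathbb{R}^n$ be the simplex, $M:\Delta\to\Delta$ the Mönkemeyer map and $T:\Delta\to\Delta$ the tent map defined in the context. There exists a unique homeomorphism $\Phi:\Delta\to\Delta$ such that $T=\Phi\circ M\circ\Phi^{-1}$.
   Context: Fix an integer $n\ge1$ and identify $\mathbb{R}^n$ with the hyperplane $\{x_{n+1}=1\}$ of $\mathbb{R}^{n+1}$. A vector $(\alpha_1,\ldots,\alpha_{n+1})\in\mathbb{R}^{n+1}$ with $\alpha_{n+1}>0$ gives, in projective coordinates, the point $(\alpha_1/\alpha_{n+1},\ldots,\alpha_n/\alpha_{n+1})$ of $\mathbb{R}^n$. Let $V$ be the $(n+1)\times(n+1)$ matrix all of whose entries are $0$, except $V_{ij}=1$ whenever $i=n+1$, or $j\ge2$ and $i+j\le n+2$. Let $\Delta$ be the $n$-simplex whose vertices $v_1,\ldots,v_{n+1}$ are given in projective coordinates by the columns of $V$ (so $\Delta=\{1\ge x_1\ge x_2\ge\cdots\ge x_n\ge0\}$). Let $A_0$ be the $(n+1)\times(n+1)$ matrix whose entries are $0$ except for entries $1$ in positions $(1,1)$, $(1,n+1)$, $(2,n+1)$ and $(j+1,j)$ for $2\le j\le n$; let $A_1$ be the same matrix except that the $1$ in position $(1,1)$ is moved to position $(2,1)$. For $a=0,1$ let $\Delta_a$ be the simplex whose vertices are given in projective coordinates by the columns of $VA_a$; one has $\Delta=\Delta_0\cup\Delta_1$. For $a=0,1$ the matrix $M_a=VA_a^{-1}V^{-1}\in\mathrm{GL}_{n+1}(\mathbb{Z})$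 induces a fractional-linear homeomorphism, also denoted $M_a$, from $\Delta_a$ to $\Delta$: the projective coordinates of $M_a(x)$ are $M_a(x_1\cdots x_n\,1)^{tr}$. The maps $M_0,M_1$ agree on $\Delta_0\cap\Delta_1$, and the Mönkemeyer map $M:\Delta\to\Delta$ is the continuous map with $M(x)=M_a(x)$ for $x\in\Delta_a$. In affine coordinates, $M(x_1,\ldots,x_n)=\bigl(\frac{x_1}{1-x_n},\frac{x_1-x_n}{1-x_n},\ldots,\frac{x_{n-1}-x_n}{1-x_n}\bigr)$ if $x_1+x_n\le1$ (i.e. on $\Delta_0$), and $M(x_1,\ldots,x_n)=\bigl(\frac{1-x_n}{x_1},\frac{x_1-x_n}{x_1},\ldots,\frac{x_{n-1}-x_n}{x_1}\bigr)$ if $x_1+x_n\ge1$ (i.e. on $\Delta_1$). For $a=0,1$ let $B_a$ be the matrix identical to $A_a$ except that the two $1$'s in the last column are replaced by $1/2$. The matrix $T_a=VB_a^{-1}V^{-1}$ has last row $(0\cdots0\,1)$ and induces an affine homeomorphism, also denoted $T_a$, from $\Delta_a$ to $\Delta$, by $T_a(x_1\cdots x_n\,1)^{tr}=(y_1\cdots y_n\,1)^{tr}$. The maps $T_0,T_1$ agree on $\Delta_0\cap\Delta_1$, and the tent map $T:\Delta\to\Delta$ is the continuous map with $T(x)=T_a(x)$ for $x\in\Delta_a$. In affine coordinates, $T(x_1,\ldots,x_n)=(x_1+x_n,x_1-x_n,\ldots,x_{n-1}-x_n)$ if $x_1+x_n\le1$, and $T(x_1,\ldots,x_n)=(2-x_1-x_n,x_1-x_n,\ldots,x_{n-1}-x_n)$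 if $x_1+x_n\ge1$. (For $n=1$ only the first coordinate is present in these formulas.) *)

theory Defs
  imports "HOL-Homology.Simplices" "Jordan_Normal_Form.Gauss_Jordan_Elimination"
    "Jordan_Normal_Form.Determinant"
begin

text \<open>
  Points of \<open>\<real>\<^sup>n\<close> are the elements of \<^term>\<open>topspace (Euclidean_space n)\<close>, i.e.\ functions
  \<open>x :: nat \<Rightarrow> real\<close> with \<open>x i = 0\<close> for \<open>i \<ge> n\<close>.  All indices are shifted down by one: the coordinate
  \<open>x\<^sub>i\<close> is \<open>x (i - 1)\<close>, and the rows and columns of \<open>(n + 1) \<times> (n + 1)\<close> matrices are numbered
  \<open>0, \<dots>, n\<close>.
\<close>

definition homogenize :: "nat \<Rightarrow> (nat \<Rightarrow> real) \<Rightarrow> real Matrix.vec" where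
  "homogenize n x = Matrix.vec (Suc n) (\<lambda>i. if i < n then x i else 1)"

definition proj_point :: "nat \<Rightarrow> real Matrix.vec \<Rightarrow> (nat \<Rightarrow> real)" where
  "proj_point n v = (\<lambda>i. if i < n then vec_index v i / vec_index v n else 0)"

definition column_simplex :: "nat \<Rightarrow> real Matrix.mat \<Rightarrow> (nat \<Rightarrow> real) set" where
  "column_simplex n W =
     oriented_simplex n (\<lambda>j. proj_point n (Matrix.col W j)) ` standard_simplex n"

definition V_mat :: "nat \<Rightarrow> real Matrix.mat" where
  "V_mat n = Matrix.mat (Suc n) (Suc n)
     (\<lambda>(i, j). if i = n \<or> (1 \<le> j \<and> i + j \<le> n) then 1 else 0)"

text \<open>For \<open>a = 0, 1\<close> the entry in the first column is in the row with (shifted) index \<open>a\<close>.\<close>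

definition A_mat :: "nat \<Rightarrow> nat \<Rightarrow> real Matrix.mat" where
  "A_mat n a = Matrix.mat (Suc n) (Suc n)
     (\<lambda>(i, j). if (i, j) \<in> {(a, 0), (0, n), (1, n)} \<or> (1 \<le> j \<and> j < n \<and> i = Suc j)
               then 1 else 0)"

definition B_mat :: "nat \<Rightarrow> nat \<Rightarrow> real Matrix.mat" where
  "B_mat n a = Matrix.mat (Suc n) (Suc n)
     (\<lambda>(i, j). if j = n \<and> A_mat n a $$ (i, j) = 1 then 1 / 2 else A_mat n a $$ (i, j))"

definition Delta :: "nat \<Rightarrow> (nat \<Rightarrow> real) set" where
  "Delta n = column_simplex n (V_mat n)"

definition Delta_part :: "nat \<Rightarrow> nat \<Rightarrow> (nat \<Rightarrow> real) set" where
  "Delta_part n a = column_simplex n (V_mat n * A_mat n a)"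

definition Delta_top :: "nat \<Rightarrow> (nat \<Rightarrow> real) topology" where
  "Delta_top n = subtopology (Euclidean_space n) (Delta n)"

text \<open>
  \<^const>\<open>mat_inverse\<close> is option-valued; the matrices inverted below are all invertible
  (\<open>mat_inverse_V\<close>, \<open>mat_inverse_A\<close>, \<open>mat_inverse_B\<close>).
\<close>

definition M_mat :: "nat \<Rightarrow> nat \<Rightarrow> real Matrix.mat" where
  "M_mat n a = V_mat n * the (mat_inverse (A_mat n a)) * the (mat_inverse (V_mat n))"

definition T_mat :: "nat \<Rightarrow> nat \<Rightarrow> real Matrix.mat" where
  "T_mat n a = V_mat n * the (mat_inverse (B_mat n a)) * the (mat_inverse (V_mat n))"

definition M_branch :: "nat \<Rightarrow> nat \<Rightarrow> (nat \<Rightarrow> real) \<Rightarrow> (nat \<Rightarrow> real)" where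
  "M_branch n a x = proj_point n (M_mat n a *\<^sub>v homogenize n x)"

definition T_branch :: "nat \<Rightarrow> nat \<Rightarrow> (nat \<Rightarrow> real) \<Rightarrow> (nat \<Rightarrow> real)" where
  "T_branch n a x = (\<lambda>i. if i < n then vec_index (T_mat n a *\<^sub>v homogenize n x) i else 0)"

text \<open>
  The two branches agree on the overlap (\<open>Moenkemeyer_on_part\<close>, \<open>Tent_on_part\<close>), so preferring
  branch \<open>0\<close> there is immaterial.
\<close>

definition Moenkemeyer :: "nat \<Rightarrow> (nat \<Rightarrow> real) \<Rightarrow> (nat \<Rightarrow> real)" where
  "Moenkemeyer n x = (if x \<in> Delta_part n 0 then M_branch n 0 x else M_branch n 1 x)"

definition Tent :: "nat \<Rightarrow> (nat \<Rightarrow> real) \<Rightarrow> (nat \<Rightarrow> real)" where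
  "Tent n x = (if x \<in> Delta_part n 0 then T_branch n 0 x else T_branch n 1 x)"

lemma mat_inverse_unique:
  fixes A :: "real Matrix.mat"
  assumes A: "A \<in> carrier_mat n n" and B: "B \<in> carrier_mat n n" and BA: "B * A = 1\<^sub>m n"
  shows "mat_inverse A = Some B"
proof -
  have AB: "A * B = 1\<^sub>m n" by (rule mat_mult_left_right_inverse[OF B A BA])
  have "A \<in> Units (ring_mat TYPE(real) n ())"
    using A B AB BA unfolding Units_def ring_mat_simps by auto
  then obtain C where C: "mat_inverse A = Some C"
    using mat_inverse(1)[OF A, where b="()"] by (cases "mat_inverse A") blast+
  have AC: "A * C = 1\<^sub>m n" and Cc: "C \<in> carrier_mat n n" using mat_inverse(2)[OF A C] by auto
  have "C = B * A * C" using BA left_mult_one_mat[OF Cc] by simp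
  also have "\<dots> = B * (A * C)" by (rule assoc_mult_mat[OF B A Cc])
  also have "\<dots> = B" using AC right_mult_one_mat[OF B] by simp
  finally have "C = B" .
  with C show ?thesis by simp
qed

lemma matrix_carriers [simp]:
  "V_mat n \<in> carrier_mat (Suc n) (Suc n)" "A_mat n a \<in> carrier_mat (Suc n) (Suc n)"
  "B_mat n a \<in> carrier_mat (Suc n) (Suc n)"
  by (auto simp: V_mat_def A_mat_def B_mat_def)

definition V_inv :: "nat \<Rightarrow> real Matrix.mat" where
  "V_inv n = Matrix.mat (Suc n) (Suc n)
     (\<lambda>(r, i). (if i = n - r then 1 else 0) -
       (if i = (if r = 0 then 0 else n + 1 - r) \<and> r \<noteq> 1 then 1 else (0::real)))"

lemma mult_entry:
  fixes A B :: "real Matrix.mat"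
  assumes "A \<in> carrier_mat N N" "B \<in> carrier_mat N N" "i < N" "j < N"
  shows "(A * B) $$ (i,j) = (\<Sum>k<N. A $$ (i,k) * B $$ (k,j))"
  using assms by (simp add: scalar_prod_def atLeast0LessThan)

lemma row_deltas:
  fixes f :: "nat \<Rightarrow> real"
  assumes "p < N" "q < N"
  shows "(\<Sum>k<N. ((if k = p then c else 0) + (if k = q then d else 0)) * f k) = c * f p + d * f q"
proof -
  have "(\<Sum>k<N. ((if k = p then c else 0) + (if k = q then d else 0)) * f k) =
     (\<Sum>k<N. (if k = p then c * f k else 0) + (if k = q then d * f k else 0))"
    by (rule sum.cong) (auto simp: distrib_right)
  also have "\<dots> = c * f p + d * f q" using assms by (auto simp: sum.distrib distrib_right)
  finally show ?thesis .
qed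

lemma mult_rows:
  fixes A B :: "real Matrix.mat"
  assumes "A \<in> carrier_mat N N" "B \<in> carrier_mat N N" "i < N" "j < N" "p < N" "q < N"
    "\<And>k. k < N \<Longrightarrow> A $$ (i,k) = (if k = p then c else 0) + (if k = q then d else 0)"
  shows "(A * B) $$ (i,j) = c * B $$ (p,j) + d * B $$ (q,j)"
  unfolding mult_entry[OF assms(1-4)] using row_deltas[of p N q c d "\<lambda>k. B $$ (k,j)"] assms
  by simp

lemma V_entry:
  "i \<le> n \<Longrightarrow> j \<le> n \<Longrightarrow> V_mat n $$ (i, j) = (if i = n \<or> (1 \<le> j \<and> i + j \<le> n) then 1 else 0)"
  by (simp add: V_mat_def)

lemma V_inv:
  assumes "n \<ge> 1"
  shows "V_inv n * V_mat n = 1\<^sub>m (Suc n)"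
proof (rule eq_matI)
  fix i j assume "i < dim_row (1\<^sub>m (Suc n))" "j < dim_col (1\<^sub>m (Suc n))"
  then have ij: "i < Suc n" "j < Suc n" by auto
  have C: "V_inv n \<in> carrier_mat (Suc n) (Suc n)" by (simp add: V_inv_def)
  consider "i = 0" | "i = 1" | "i \<ge> 2" by linarith
  then show "(V_inv n * V_mat n) $$ (i,j) = 1\<^sub>m (Suc n) $$ (i,j)"
  proof cases
    case 1
    have "(V_inv n * V_mat n) $$ (i,j) = 1 * V_mat n $$ (n,j) + (-1) * V_mat n $$ (0,j)"
      using ij 1 by (intro mult_rows[OF C matrix_carriers(1) ij]) (simp_all add: V_inv_def)
    then show ?thesis using 1 ij assms by (simp add: V_entry)
  next
    case 2
    have "(V_inv n * V_mat n) $$ (i,j) = 1 * V_mat n $$ (n - 1,j) + 0 * V_mat n $$ (0,j)"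
      using ij 2 by (intro mult_rows[OF C matrix_carriers(1) ij]) (simp_all add: V_inv_def)
    moreover have "n - 1 + j \<le> n \<longleftrightarrow> j \<le> 1" "n - 1 \<noteq> n" using assms by linarith+
    ultimately show ?thesis using 2 ij assms by (simp add: V_entry)
  next
    case 3
    have "(V_inv n * V_mat n) $$ (i,j) = 1 * V_mat n $$ (n - i,j) + (-1) * V_mat n $$ (n + 1 - i,j)"
      using ij 3 by (intro mult_rows[OF C matrix_carriers(1) ij]) (simp_all add: V_inv_def)
    moreover have "n - i + j \<le> n \<longleftrightarrow> j \<le> i" "n + 1 - i + j \<le> n \<longleftrightarrow> j < i"
      "n - i \<noteq> n" "n + 1 - i \<noteq> n" using ij 3 by linarith+
    ultimately show ?thesis using 3 ij assms
      by (cases i j rule: linorder_cases) (simp_all add: V_entry)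
  qed
qed (simp_all add: V_inv_def V_mat_def)

lemma mat_inverse_V: "n \<ge> 1 \<Longrightarrow> mat_inverse (V_mat n) = Some (V_inv n)"
  by (rule mat_inverse_unique[where n="Suc n"]) (simp_all add: V_inv, simp add: V_inv_def)

definition A_inv :: "nat \<Rightarrow> nat \<Rightarrow> real \<Rightarrow> real Matrix.mat" where
  "A_inv n a c = Matrix.mat (Suc n) (Suc n)
     (\<lambda>(r, i). if r = 0 then (if i = a then 1 else 0) - (if i = 1 - a then 1 else 0)
       else if r = n then (if i = 1 - a then c else 0) else (if i = Suc r then 1 else (0::real)))"

lemma A_entry:
  assumes "n \<ge> 1" "i \<le> n" "j \<le> n"
  shows "A_mat n a $$ (i,j) = (if j = 0 then if i = a then 1 else 0
      else if j = n then if i \<le> 1 then 1 else 0 else if i = Suc j then 1 else 0)"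
  using assms by (auto simp: A_mat_def)

lemma B_entry:
  assumes "n \<ge> 1" "i \<le> n" "j \<le> n"
  shows "B_mat n a $$ (i,j) = (if j = n then 1/2 else 1) * A_mat n a $$ (i,j)"
  using assms A_entry[OF assms] by (simp add: B_mat_def)

lemma A_inv:
  assumes "n \<ge> 1" "a \<le> 1"
  shows "A_inv n a 1 * A_mat n a = 1\<^sub>m (Suc n)" "A_inv n a 2 * B_mat n a = 1\<^sub>m (Suc n)"
proof -
  have a: "a = 0 \<or> a = 1" using assms by auto
  have *: "(A_inv n a c * X) $$ (i,j) = (if i = 0 then X $$ (a,j) - X $$ (1 - a,j)
     else if i = n then c * X $$ (1 - a,j) else X $$ (Suc i,j))" if ij: "i < Suc n" "j < Suc n"
     "X \<in> carrier_mat (Suc n) (Suc n)" for i j c X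
  proof -
    have A: "A_inv n a c \<in> carrier_mat (Suc n) (Suc n)" by (simp add: A_inv_def)
    consider "i = 0" | "i = n" "i \<noteq> 0" | "i \<noteq> 0" "i < n"
      using ij by (cases "i = 0"; cases "i = n") auto
    then show ?thesis
    proof cases
      case 1
      have "(A_inv n a c * X) $$ (i,j) = 1 * X $$ (a,j) + (-1) * X $$ (1 - a,j)"
        using assms 1 by (intro mult_rows[OF A that(3,1,2)]) (simp_all add: A_inv_def)
      then show ?thesis using 1 by simp
    next
      case 2
      have "(A_inv n a c * X) $$ (i,j) = c * X $$ (1 - a,j) + 0 * X $$ (1 - a,j)"
        using assms 2 by (intro mult_rows[OF A that(3,1,2)]) (simp_all add: A_inv_def)
      then show ?thesis using 2 by simp
    next
      case 3
      have "(A_inv n a c * X) $$ (i,j) = 1 * X $$ (Suc i,j) + 0 * X $$ (1 - a,j)"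
        using assms 3 by (intro mult_rows[OF A that(3,1,2)]) (simp_all add: A_inv_def)
      then show ?thesis using 3 by simp
    qed
  qed
  show "A_inv n a 1 * A_mat n a = 1\<^sub>m (Suc n)"
  proof (rule eq_matI)
    fix i j assume "i < dim_row (1\<^sub>m (Suc n))" "j < dim_col (1\<^sub>m (Suc n))"
    then have ij: "i < Suc n" "j < Suc n" by auto
    show "(A_inv n a 1 * A_mat n a) $$ (i,j) = 1\<^sub>m (Suc n) $$ (i,j)"
      unfolding *[OF ij matrix_carriers(2)] using a assms(1) ij by (elim disjE) (auto simp: A_entry)
  qed (auto simp: A_inv_def A_mat_def)
  show "A_inv n a 2 * B_mat n a = 1\<^sub>m (Suc n)"
  proof (rule eq_matI)
    fix i j assume "i < dim_row (1\<^sub>m (Suc n))" "j < dim_col (1\<^sub>m (Suc n))"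
    then have ij: "i < Suc n" "j < Suc n" by auto
    show "(A_inv n a 2 * B_mat n a) $$ (i,j) = 1\<^sub>m (Suc n) $$ (i,j)"
      unfolding *[OF ij matrix_carriers(3)] using a assms(1) ij by (elim disjE) (auto simp: A_entry B_entry)
  qed (auto simp: A_inv_def B_mat_def)
qed

lemma mat_inverse_A: "n \<ge> 1 \<Longrightarrow> a \<le> 1 \<Longrightarrow> mat_inverse (A_mat n a) = Some (A_inv n a 1)"
  using A_inv[of n a] by (intro mat_inverse_unique[where n="Suc n"]) (simp_all add: A_inv_def)
lemma mat_inverse_B: "n \<ge> 1 \<Longrightarrow> a \<le> 1 \<Longrightarrow> mat_inverse (B_mat n a) = Some (A_inv n a 2)"
  using A_inv[of n a] by (intro mat_inverse_unique[where n="Suc n"]) (simp_all add: A_inv_def)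

lemma branch_mat:
  assumes n: "n \<ge> 1" and X: "X \<in> carrier_mat (Suc n) (Suc n)" and Y: "Y \<in> carrier_mat (Suc n) (Suc n)"
   and X': "mat_inverse X = Some X'" and NV: "Y * V_mat n * X = V_mat n"
  shows "V_mat n * the (mat_inverse X) * the (mat_inverse (V_mat n)) = Y"
proof -
  have x: "X' \<in> carrier_mat (Suc n) (Suc n)" "X * X' = 1\<^sub>m (Suc n)" using mat_inverse(2)[OF X X'] by auto
  have v: "V_inv n \<in> carrier_mat (Suc n) (Suc n)" "V_mat n * V_inv n = 1\<^sub>m (Suc n)"
    using mat_inverse(2)[OF matrix_carriers(1) mat_inverse_V[OF n]] by auto
  have "V_mat n * X' = Y * V_mat n * (X * X')"
    using assoc_mult_mat[of "Y * V_mat n" "Suc n" "Suc n" X "Suc n" X' "Suc n"] NV X x Y mult_carrier_mat[OF Y matrix_carriers(1)] by simp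
  also have "\<dots> = Y * V_mat n" using x right_mult_one_mat[OF mult_carrier_mat[OF Y matrix_carriers(1)]] by simp
  finally have "V_mat n * X' * V_inv n = Y * (V_mat n * V_inv n)"
    using assoc_mult_mat[OF Y matrix_carriers(1) v(1)] by simp
  also have "\<dots> = Y" using v Y by simp
  finally show ?thesis using X' mat_inverse_V[OF n] by simp
qed

lemma mult_cols:
  fixes A B :: "real Matrix.mat"
  assumes "A \<in> carrier_mat N N" "B \<in> carrier_mat N N" "i < N" "j < N" "p < N" "q < N"
    "\<And>k. k < N \<Longrightarrow> B $$ (k,j) = (if k = p then c else 0) + (if k = q then d else 0)"
  shows "(A * B) $$ (i,j) = c * A $$ (i,p) + d * A $$ (i,q)"
  unfolding mult_entry[OF assms(1-4)] using row_deltas[of p N q c d "\<lambda>k. A $$ (i,k)"] assms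
  by (simp add: mult.commute)

lemma VA_entry:
  assumes "n \<ge> 1" "a \<le> 1" "i \<le> n" "j \<le> n"
  shows "(V_mat n * A_mat n a) $$ (i,j) =
     V_mat n $$ (i, if j = 0 then a else if j = n then 1 else Suc j)
       + (if j = n then V_mat n $$ (i,0) else 0)"
    and "(V_mat n * B_mat n a) $$ (i,j) =
     (if j = n then 1/2 else 1) * (V_mat n * A_mat n a) $$ (i,j)"
proof -
  have ij: "i < Suc n" "j < Suc n" using assms by auto
  have *: "(V_mat n * X) $$ (i,j) = (if j = n then c else 1) * (V_mat n $$ (i, if j = 0 then a else if j = n then 1 else Suc j)
       + (if j = n then V_mat n $$ (i,0) else 0))"
    if X: "X \<in> carrier_mat (Suc n) (Suc n)"
     "\<And>k. k \<le> n \<Longrightarrow> X $$ (k,j) = (if j = n then c else 1) * A_mat n a $$ (k,j)" for X c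
  proof -
    consider "j = 0" | "j = n" "j \<noteq> 0" | "j \<noteq> 0" "j < n" using assms(4) by (cases "j = 0"; cases "j = n") auto
    then show ?thesis
    proof cases
      case 1
      have "(V_mat n * X) $$ (i,j) = 1 * V_mat n $$ (i, a) + 0 * V_mat n $$ (i,0)"
        using assms 1 X(2) by (intro mult_cols[OF matrix_carriers(1) X(1) ij]) (simp_all add: A_entry)
      then show ?thesis using 1 assms(1) by simp
    next
      case 2
      have "(V_mat n * X) $$ (i,j) = c * V_mat n $$ (i, 1) + c * V_mat n $$ (i,0)"
      proof (rule mult_cols[OF matrix_carriers(1) X(1) ij])
        fix k assume "k < Suc n"
        then show "X $$ (k,j) = (if k = 1 then c else 0) + (if k = 0 then c else 0)"
          using 2 assms(1) X(2)[of k] by (cases "k = 0"; cases "k = 1") (simp_all add: A_entry)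
      qed (use assms in auto)
      then show ?thesis using 2 by (simp add: distrib_left)
    next
      case 3
      have "(V_mat n * X) $$ (i,j) = 1 * V_mat n $$ (i, Suc j) + 0 * V_mat n $$ (i,0)"
        using assms 3 X(2) by (intro mult_cols[OF matrix_carriers(1) X(1) ij]) (simp_all add: A_entry)
      then show ?thesis using 3 by simp
    qed
  qed
  show A: "(V_mat n * A_mat n a) $$ (i,j) =
     V_mat n $$ (i, if j = 0 then a else if j = n then 1 else Suc j)
       + (if j = n then V_mat n $$ (i,0) else 0)"
    using *[of "A_mat n a" 1] matrix_carriers(2) by simp
  show "(V_mat n * B_mat n a) $$ (i,j) =
     (if j = n then 1/2 else 1) * (V_mat n * A_mat n a) $$ (i,j)"
    unfolding A by (rule *[OF matrix_carriers(3)]) (use assms B_entry in auto)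
qed

lemmas VB_entry = VA_entry(2)

definition M_explicit :: "nat \<Rightarrow> nat \<Rightarrow> real Matrix.mat" where
  "M_explicit n a = Matrix.mat (Suc n) (Suc n) (\<lambda>(i,k).
   if i = (if a = 0 then n else 0) then (if k = n then 1 else 0) + (if k = n - 1 then -1 else 0)
   else if i = (if a = 0 then 0 else n) then (if k = 0 then 1 else 0)
   else (if k = i - 1 then 1 else 0) + (if k = n - 1 then -1 else (0::real)))"

definition T_explicit :: "nat \<Rightarrow> nat \<Rightarrow> real Matrix.mat" where
  "T_explicit n a = Matrix.mat (Suc n) (Suc n) (\<lambda>(i,k).
   if i = n then (if k = n then 1 else 0)
   else if i = 0 then (if a = 0 then 1 else -1) * ((if k = 0 then 1 else 0) + (if k = n - 1 then 1 else 0))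
     + (if k = n \<and> a \<noteq> 0 then 2 else 0)
   else (if k = i - 1 then 1 else 0) + (if k = n - 1 then -1 else (0::real)))"

lemma row_deltas3:
  fixes f :: "nat \<Rightarrow> real"
  assumes "p < N" "q < N" "r < N"
    "\<And>k. k < N \<Longrightarrow> g k = (if k = p then c else 0) + (if k = q then d else 0) + (if k = r then e else 0)"
  shows "(\<Sum>k<N. g k * f k) = c * f p + d * f q + e * f r"
proof -
  have "(\<Sum>k<N. g k * f k) =
     (\<Sum>k<N. (if k = p then c * f k else 0) + (if k = q then d * f k else 0) + (if k = r then e * f k else 0))"
    using assms(4) by (intro sum.cong) (auto simp: distrib_right)
  also have "\<dots> = c * f p + d * f q + e * f r" using assms by (auto simp: sum.distrib distrib_right)
  finally show ?thesis .
qed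

lemma M_explicit_row:
  fixes f :: "nat \<Rightarrow> real"
  assumes "n \<ge> 1" "i \<le> n" "a \<le> 1"
  shows "(\<Sum>k<Suc n. M_explicit n a $$ (i,k) * f k) =
    (if i = (if a = 0 then n else 0) then f n - f (n - 1)
     else if i = (if a = 0 then 0 else n) then f 0
     else f (i - 1) - f (n - 1))"
proof -
  let ?i = "if a = 0 then n else 0" and ?j = "if a = 0 then 0 else n"
  have ne: "?i \<noteq> ?j" using assms by auto
  consider "i = ?i" | "i = ?j" "i \<noteq> ?i" | "i \<noteq> ?i" "i \<noteq> ?j" "i \<noteq> 0"
    by (cases "a = 0"; cases "i = 0"; cases "i = n") auto
  then show ?thesis
  proof cases
    case 1
    have "(\<Sum>k<Suc n. M_explicit n a $$ (i,k) * f k) = 1 * f n + (-1) * f (n - 1) + 0 * f 0"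
      using assms 1 ne by (intro row_deltas3) (simp_all add: M_explicit_def)
    then show ?thesis using 1 by simp
  next
    case 2
    have "(\<Sum>k<Suc n. M_explicit n a $$ (i,k) * f k) = 1 * f 0 + 0 * f 0 + 0 * f 0"
      using assms 2 ne by (intro row_deltas3) (simp_all add: M_explicit_def)
    then show ?thesis using 2 by simp
  next
    case 3
    have "(\<Sum>k<Suc n. M_explicit n a $$ (i,k) * f k) = 1 * f (i - 1) + (-1) * f (n - 1) + 0 * f 0"
      using assms 3 ne by (intro row_deltas3) (simp_all add: M_explicit_def)
    then show ?thesis using 3 by simp
  qed
qed

lemma T_explicit_row:
  fixes f :: "nat \<Rightarrow> real"
  assumes "n \<ge> 1" "i \<le> n" "a \<le> 1"
  shows "(\<Sum>k<Suc n. T_explicit n a $$ (i,k) * f k) =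
    (if i = n then f n
     else if i = 0 then if a = 0 then f 0 + f (n - 1) else 2 * f n - f 0 - f (n - 1)
     else f (i - 1) - f (n - 1))"
proof -
  consider "i = n" | "i = 0" "i \<noteq> n" "a = 0" | "i = 0" "i \<noteq> n" "a \<noteq> 0" | "i \<noteq> 0" "i \<noteq> n" by blast
  then show ?thesis
  proof cases
    case 1
    have "(\<Sum>k<Suc n. T_explicit n a $$ (i,k) * f k) = 1 * f n + 0 * f 0 + 0 * f 0"
      using assms 1 by (intro row_deltas3) (simp_all add: T_explicit_def)
    then show ?thesis using 1 by simp
  next
    case 2
    have "(\<Sum>k<Suc n. T_explicit n a $$ (i,k) * f k) = 1 * f 0 + 1 * f (n - 1) + 0 * f 0"
      using assms 2 by (intro row_deltas3) (simp_all add: T_explicit_def)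
    then show ?thesis using 2 by simp
  next
    case 3
    have "(\<Sum>k<Suc n. T_explicit n a $$ (i,k) * f k) = (-1) * f 0 + (-1) * f (n - 1) + 2 * f n"
      using assms 3 by (intro row_deltas3) (simp_all add: T_explicit_def)
    then show ?thesis using 3 by simp
  next
    case 4
    have "(\<Sum>k<Suc n. T_explicit n a $$ (i,k) * f k) = 1 * f (i - 1) + (-1) * f (n - 1) + 0 * f 0"
      using assms 4 by (intro row_deltas3) (simp_all add: T_explicit_def)
    then show ?thesis using 4 by simp
  qed
qed

lemma M_mat_eq:
  assumes "n \<ge> 1" "a \<le> 1"
  shows "M_mat n a = M_explicit n a"
  unfolding M_mat_def
proof (rule branch_mat[OF assms(1) _ _ mat_inverse_A[OF assms]])
  have E: "M_explicit n a \<in> carrier_mat (Suc n) (Suc n)" by (auto simp: M_explicit_def)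
  show "M_explicit n a \<in> carrier_mat (Suc n) (Suc n)" by (fact E)
  show "M_explicit n a * V_mat n * A_mat n a = V_mat n"
    unfolding assoc_mult_mat[OF E matrix_carriers(1) matrix_carriers(2)]
  proof (rule eq_matI)
    fix i j assume "i < dim_row (V_mat n)" "j < dim_col (V_mat n)"
    then have ij: "i \<le> n" "j \<le> n" by (auto simp: V_mat_def)
    have a: "a = 0 \<or> a = 1" using assms(2) by auto
    have "(M_explicit n a * (V_mat n * A_mat n a)) $$ (i, j) =
      (\<Sum>k<Suc n. M_explicit n a $$ (i,k) * (V_mat n * A_mat n a) $$ (k,j))"
      using ij by (intro mult_entry[OF E mult_carrier_mat[OF matrix_carriers(1) matrix_carriers(2)]]) auto
    also have "\<dots> = V_mat n $$ (i,j)"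
      unfolding M_explicit_row[OF assms(1) ij(1) assms(2)] using assms(1) a ij
      by (elim disjE) (auto simp: VA_entry V_entry)
    finally show "(M_explicit n a * (V_mat n * A_mat n a)) $$ (i, j) = V_mat n $$ (i,j)" .
  qed (auto simp: M_explicit_def A_mat_def V_mat_def)
qed auto

lemma T_mat_eq:
  assumes "n \<ge> 1" "a \<le> 1"
  shows "T_mat n a = T_explicit n a"
  unfolding T_mat_def
proof (rule branch_mat[OF assms(1) _ _ mat_inverse_B[OF assms]])
  have E: "T_explicit n a \<in> carrier_mat (Suc n) (Suc n)" by (auto simp: T_explicit_def)
  show "T_explicit n a \<in> carrier_mat (Suc n) (Suc n)" by (fact E)
  show "T_explicit n a * V_mat n * B_mat n a = V_mat n"
    unfolding assoc_mult_mat[OF E matrix_carriers(1) matrix_carriers(3)]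
  proof (rule eq_matI)
    fix i j assume "i < dim_row (V_mat n)" "j < dim_col (V_mat n)"
    then have ij: "i \<le> n" "j \<le> n" by (auto simp: V_mat_def)
    have a: "a = 0 \<or> a = 1" using assms(2) by auto
    have "(T_explicit n a * (V_mat n * B_mat n a)) $$ (i, j) =
      (\<Sum>k<Suc n. T_explicit n a $$ (i,k) * (V_mat n * B_mat n a) $$ (k,j))"
      using ij by (intro mult_entry[OF E mult_carrier_mat[OF matrix_carriers(1) matrix_carriers(3)]]) auto
    also have "\<dots> = V_mat n $$ (i,j)"
      unfolding T_explicit_row[OF assms(1) ij(1) assms(2)] using assms(1) a ij
      by (elim disjE) (auto simp: VA_entry V_entry)
    finally show "(T_explicit n a * (V_mat n * B_mat n a)) $$ (i, j) = V_mat n $$ (i,j)" .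
  qed (auto simp: T_explicit_def B_mat_def V_mat_def)
qed auto

lemma mult_vec_entry:
  fixes A :: "real Matrix.mat"
  assumes "A \<in> carrier_mat N N" "v \<in> carrier_vec N" "i < N"
  shows "vec_index (A *\<^sub>v v) i = (\<Sum>k<N. A $$ (i,k) * vec_index v k)"
  using assms by (simp add: scalar_prod_def atLeast0LessThan)

lemma homogenize_carrier: "homogenize n x \<in> carrier_vec (Suc n)"
  by (simp add: homogenize_def)

lemma homogenize_index: "i \<le> n \<Longrightarrow> vec_index (homogenize n x) i = (if i < n then x i else 1)"
  by (simp add: homogenize_def)

lemma M_branch_affine:
  assumes n: "n \<ge> 1"
  shows "M_branch n 0 x = (\<lambda>i. if i < n then
      (if i = 0 then x 0 else x (i - 1) - x (n - 1)) / (1 - x (n - 1)) else 0)"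
    "M_branch n 1 x = (\<lambda>i. if i < n then
      (if i = 0 then 1 - x (n - 1) else x (i - 1) - x (n - 1)) / x 0 else 0)"
proof -
  let ?h = "vec_index (homogenize n x)"
  have *: "vec_index (M_mat n a *\<^sub>v homogenize n x) i = (if i = (if a = 0 then n else 0) then ?h n - ?h (n - 1)
     else if i = (if a = 0 then 0 else n) then ?h 0
     else ?h (i - 1) - ?h (n - 1))"
    if "i \<le> n" "a \<le> 1" for i a
  proof -
    have "vec_index (M_explicit n a *\<^sub>v homogenize n x) i = (\<Sum>k<Suc n. M_explicit n a $$ (i,k) * ?h k)"
      using that by (intro mult_vec_entry homogenize_carrier) (simp_all add: M_explicit_def)
    then show ?thesis unfolding M_mat_eq[OF n that(2)] M_explicit_row[OF n that] .
  qed
  show "M_branch n 0 x = (\<lambda>i. if i < n then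
      (if i = 0 then x 0 else x (i - 1) - x (n - 1)) / (1 - x (n - 1)) else 0)"
    "M_branch n 1 x = (\<lambda>i. if i < n then
      (if i = 0 then 1 - x (n - 1) else x (i - 1) - x (n - 1)) / x 0 else 0)"
    unfolding M_branch_def proj_point_def using n
    by (intro ext, simp add: * homogenize_index, linarith)+
qed

lemma T_branch_affine:
  assumes n: "n \<ge> 1"
  shows "T_branch n 0 x = (\<lambda>i. if i < n then
      (if i = 0 then x 0 + x (n - 1) else x (i - 1) - x (n - 1)) else 0)"
    "T_branch n 1 x = (\<lambda>i. if i < n then
      (if i = 0 then 2 - x 0 - x (n - 1) else x (i - 1) - x (n - 1)) else 0)"
proof -
  let ?h = "vec_index (homogenize n x)"
  have *: "vec_index (T_mat n a *\<^sub>v homogenize n x) i = (if i = n then ?h n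
     else if i = 0 then if a = 0 then ?h 0 + ?h (n - 1) else 2 * ?h n - ?h 0 - ?h (n - 1)
     else ?h (i - 1) - ?h (n - 1))"
    if "i \<le> n" "a \<le> 1" for i a
  proof -
    have "vec_index (T_explicit n a *\<^sub>v homogenize n x) i = (\<Sum>k<Suc n. T_explicit n a $$ (i,k) * ?h k)"
      using that by (intro mult_vec_entry homogenize_carrier) (simp_all add: T_explicit_def)
    then show ?thesis unfolding T_mat_eq[OF n that(2)] T_explicit_row[OF n that] .
  qed
  show "T_branch n 0 x = (\<lambda>i. if i < n then
      (if i = 0 then x 0 + x (n - 1) else x (i - 1) - x (n - 1)) else 0)"
    "T_branch n 1 x = (\<lambda>i. if i < n then
      (if i = 0 then 2 - x 0 - x (n - 1) else x (i - 1) - x (n - 1)) else 0)"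
    unfolding T_branch_def using n
    by (intro ext, simp add: * homogenize_index, linarith)+
qed

lemma column_simplex_eq:
  assumes W: "W \<in> carrier_mat (Suc n) (Suc n)" and W': "W' \<in> carrier_mat (Suc n) (Suc n)"
    and WW': "W * W' = 1\<^sub>m (Suc n)" "W' * W = 1\<^sub>m (Suc n)"
    and last: "\<And>j. j \<le> n \<Longrightarrow> W $$ (n,j) = 1"
  shows "column_simplex n W =
    {x. (\<forall>i\<ge>n. x i = 0) \<and> (\<forall>r\<le>n. 0 \<le> vec_index (W' *\<^sub>v homogenize n x) r)}"
proof -
  have pp: "proj_point n (Matrix.col W j) i = (if i < n then W $$ (i,j) else 0)" if "j \<le> n" for i j
    using that last W by (auto simp: proj_point_def)
  let ?F = "oriented_simplex n (\<lambda>j. proj_point n (Matrix.col W j))"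
  have F: "?F w i = (if i < n then \<Sum>j<Suc n. W $$ (i,j) * w j else 0)" if "w \<in> standard_simplex n" for w i
    using that pp by (auto simp: oriented_simplex_def lessThan_Suc_atMost)
  have H: "homogenize n (?F w) = W *\<^sub>v Matrix.vec (Suc n) w" if w: "w \<in> standard_simplex n" for w
  proof (rule eq_vecI)
    fix i assume "i < dim_vec (W *\<^sub>v Matrix.vec (Suc n) w)"
    then have i: "i < Suc n" using W by simp
    have "vec_index (W *\<^sub>v Matrix.vec (Suc n) w) i = (\<Sum>k<Suc n. W $$ (i,k) * w k)"
      using mult_vec_entry[OF W _ i, of "Matrix.vec (Suc n) w"] by simp
    moreover have "(\<Sum>k<Suc n. W $$ (n,k) * w k) = 1"
      using w last by (simp add: standard_simplex_def lessThan_Suc_atMost)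
    ultimately show "vec_index (homogenize n (?F w)) i = vec_index (W *\<^sub>v Matrix.vec (Suc n) w) i"
      using i F[OF w] by (cases "i < n") (auto simp: homogenize_def less_Suc_eq)
  qed (use W in \<open>simp add: homogenize_def\<close>)
  show ?thesis
  proof (intro equalityI subsetI)
    fix x assume "x \<in> column_simplex n W"
    then obtain w where w: "w \<in> standard_simplex n" and x: "x = ?F w"
      by (auto simp: column_simplex_def)
    have "W' *\<^sub>v homogenize n x = Matrix.vec (Suc n) w"
      unfolding x H[OF w] using assoc_mult_mat_vec[OF W' W, of "Matrix.vec (Suc n) w"] WW'
      by simp
    then show "x \<in> {x. (\<forall>i\<ge>n. x i = 0) \<and> (\<forall>r\<le>n. 0 \<le> vec_index (W' *\<^sub>v homogenize n x) r)}"
      using w F[OF w] x by (auto simp: standard_simplex_def)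
  next
    fix x assume "x \<in> {x. (\<forall>i\<ge>n. x i = 0) \<and> (\<forall>r\<le>n. 0 \<le> vec_index (W' *\<^sub>v homogenize n x) r)}"
    then have x0: "\<And>i. i \<ge> n \<Longrightarrow> x i = 0" and xp: "\<And>r. r \<le> n \<Longrightarrow> 0 \<le> vec_index (W' *\<^sub>v homogenize n x) r"
      by auto
    define u where "u = W' *\<^sub>v homogenize n x"
    define w where "w r = (if r \<le> n then vec_index u r else 0)" for r
    have u: "u \<in> carrier_vec (Suc n)" unfolding u_def by (rule mult_mat_vec_carrier[OF W' homogenize_carrier])
    have "W *\<^sub>v u = homogenize n x"
      unfolding u_def using assoc_mult_mat_vec[OF W W' homogenize_carrier, of x] WW' homogenize_carrier[of n x]
      by simp
    then have e: "(\<Sum>k<Suc n. W $$ (i,k) * w k) = vec_index (homogenize n x) i" if "i \<le> n" for i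
      using mult_vec_entry[OF W u, of i] that by (simp add: w_def)
    have s: "(\<Sum>k\<le>n. w k) = 1" using e[of n] last by (simp add: homogenize_def lessThan_Suc_atMost)
    have w0: "0 \<le> w k" for k using xp by (simp add: w_def u_def)
    have "w k \<le> 1" for k
    proof (cases "k \<le> n")
      case True
      then have "w k \<le> (\<Sum>k\<le>n. w k)" using w0 by (intro member_le_sum) auto
      then show ?thesis using s by simp
    qed (simp add: w_def)
    then have w: "w \<in> standard_simplex n" using w0 s by (auto simp: standard_simplex_def w_def)
    have "?F w = x"
    proof
      fix i show "?F w i = x i" using F[OF w, of i] e[of i] x0[of i] by (auto simp: homogenize_def)
    qed
    then show "x \<in> column_simplex n W" using w by (auto simp: column_simplex_def)
  qed
qed

lemma V_inv_hom:
  assumes "n \<ge> 1" "r \<le> n" "\<forall>i\<ge>n. x i = 0"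
  shows "vec_index (V_inv n *\<^sub>v homogenize n x) r =
    (if r = 0 then 1 - x 0 else x (n - r) - x (n + 1 - r))"
proof -
  have "vec_index (V_inv n *\<^sub>v homogenize n x) r = (\<Sum>k<Suc n. V_inv n $$ (r,k) * vec_index (homogenize n x) k)"
    using assms by (intro mult_vec_entry homogenize_carrier) (auto simp: V_inv_def)
  also have "\<dots> = (\<Sum>k<Suc n. ((if k = n - r then 1 else 0) +
     (if k = (if r = 0 then 0 else if r = 1 then 0 else n + 1 - r) then if r = 1 then 0 else -1 else 0))
     * vec_index (homogenize n x) k)"
    using assms by (intro sum.cong) (auto simp: V_inv_def)
  also have "\<dots> = 1 * vec_index (homogenize n x) (n - r) + (if r = 1 then 0 else -1) *
     vec_index (homogenize n x) (if r = 0 then 0 else if r = 1 then 0 else n + 1 - r)"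
    using assms by (intro row_deltas) auto
  also have "\<dots> = (if r = 0 then 1 - x 0 else x (n - r) - x (n + 1 - r))"
    using assms by (auto simp: homogenize_def)
  finally show ?thesis .
qed

lemma Delta_raw:
  assumes "n \<ge> 1"
  shows "Delta n = {x. (\<forall>i\<ge>n. x i = 0) \<and> x 0 \<le> 1 \<and> (\<forall>r\<in>{1..n}. x (n + 1 - r) \<le> x (n - r))}"
proof -
  have V: "V_inv n \<in> carrier_mat (Suc n) (Suc n)" "V_mat n * V_inv n = 1\<^sub>m (Suc n)" "V_inv n * V_mat n = 1\<^sub>m (Suc n)"
    using mat_inverse(2)[OF matrix_carriers(1) mat_inverse_V[OF assms]] by auto
  have a: "(\<forall>r\<le>n. P r) \<longleftrightarrow> P 0 \<and> (\<forall>r\<in>{1..n}. P r)" for P :: "nat \<Rightarrow> bool"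
    by (metis One_nat_def Suc_leI atLeastAtMost_iff gr0I zero_le)
  have "Delta n = {x. (\<forall>i\<ge>n. x i = 0) \<and> (\<forall>r\<le>n. 0 \<le> vec_index (V_inv n *\<^sub>v homogenize n x) r)}"
    unfolding Delta_def by (rule column_simplex_eq[OF matrix_carriers(1) V(1-3)]) (simp add: V_entry)
  also have "\<dots> = {x. (\<forall>i\<ge>n. x i = 0) \<and> x 0 \<le> 1 \<and> (\<forall>r\<in>{1..n}. x (n + 1 - r) \<le> x (n - r))}"
  proof -
    have "(\<forall>r\<le>n. 0 \<le> vec_index (V_inv n *\<^sub>v homogenize n x) r) \<longleftrightarrow>
        x 0 \<le> 1 \<and> (\<forall>r\<in>{1..n}. x (n + 1 - r) \<le> x (n - r))" if "\<forall>i\<ge>n. x i = 0" for x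
      unfolding a using V_inv_hom[OF assms _ that] by simp
    then show ?thesis by blast
  qed
  finally show ?thesis .
qed

lemma Delta_eq:
  assumes "n \<ge> 1"
  shows "Delta n = {x. (\<forall>i\<ge>n. x i = 0) \<and> x 0 \<le> 1 \<and> (\<forall>i. Suc i < n \<longrightarrow> x (Suc i) \<le> x i) \<and> 0 \<le> x (n - 1)}"
proof -
  have "(\<forall>r\<in>{1..n}. x (n + 1 - r) \<le> x (n - r)) \<longleftrightarrow> (\<forall>i. Suc i < n \<longrightarrow> x (Suc i) \<le> x i) \<and> 0 \<le> x (n - 1)"
    if "\<forall>i\<ge>n. x i = 0" for x :: "nat \<Rightarrow> real"
  proof
    assume L: "\<forall>r\<in>{1..n}. x (n + 1 - r) \<le> x (n - r)"
    have "x (Suc i) \<le> x i" if "i < n" for i using L[rule_format, of "n - i"] that by auto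
    then show "(\<forall>i. Suc i < n \<longrightarrow> x (Suc i) \<le> x i) \<and> 0 \<le> x (n - 1)"
      using that assms by (metis Suc_lessD Suc_pred' diff_less le_refl less_le_trans less_one)
  next
    assume R: "(\<forall>i. Suc i < n \<longrightarrow> x (Suc i) \<le> x i) \<and> 0 \<le> x (n - 1)"
    show "\<forall>r\<in>{1..n}. x (n + 1 - r) \<le> x (n - r)"
    proof
      fix r assume r: "r \<in> {1..n}"
      show "x (n + 1 - r) \<le> x (n - r)"
      proof (cases "r = 1")
        case True then show ?thesis using R that by simp
      next
        case False
        then have "n + 1 - r = Suc (n - r)" "Suc (n - r) < n" using r by auto
        then show ?thesis using R by metis
      qed
    qed
  qed
  then show ?thesis unfolding Delta_raw[OF assms] by blast
qed

lemma Delta_part_eq: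
  assumes n: "n \<ge> 1"
  shows "Delta_part n 0 = {x \<in> Delta n. x 0 + x (n - 1) \<le> 1}"
    "Delta_part n 1 = {x \<in> Delta n. x 0 + x (n - 1) \<ge> 1}"
proof -
  have V: "V_inv n \<in> carrier_mat (Suc n) (Suc n)" "V_mat n * V_inv n = 1\<^sub>m (Suc n)" "V_inv n * V_mat n = 1\<^sub>m (Suc n)"
    using mat_inverse(2)[OF matrix_carriers(1) mat_inverse_V[OF assms]] by auto
  have eq: "Delta_part n a = {x. (\<forall>i\<ge>n. x i = 0) \<and>
     (\<forall>r\<le>n. 0 \<le> vec_index (A_inv n a 2 *\<^sub>v (V_inv n *\<^sub>v homogenize n x)) r)}" if a: "a \<le> 1" for a
  proof -
    let ?A = "A_inv n a 2" and ?B = "B_mat n a"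
    have B: "?A \<in> carrier_mat (Suc n) (Suc n)" "?B * ?A = 1\<^sub>m (Suc n)" "?A * ?B = 1\<^sub>m (Suc n)"
      using mat_inverse(2)[OF matrix_carriers(3) mat_inverse_B[OF assms a]] by auto
    have VB: "V_mat n * ?B \<in> carrier_mat (Suc n) (Suc n)" by (rule mult_carrier_mat[OF matrix_carriers(1) matrix_carriers(3)])
    have AV: "?A * V_inv n \<in> carrier_mat (Suc n) (Suc n)" by (rule mult_carrier_mat[OF B(1) V(1)])
    have "?A * V_inv n * (V_mat n * ?B) = ?A * (V_inv n * V_mat n * ?B)"
      using assoc_mult_mat[OF B(1) V(1) VB] assoc_mult_mat[OF V(1) matrix_carriers(1) matrix_carriers(3)] by simp
    then have 1: "?A * V_inv n * (V_mat n * ?B) = 1\<^sub>m (Suc n)" using V B left_mult_one_mat[OF matrix_carriers(3)] by simp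
    have 2: "V_mat n * ?B * (?A * V_inv n) = 1\<^sub>m (Suc n)" by (rule mat_mult_left_right_inverse[OF AV VB 1])
    have L: "(V_mat n * B_mat n a) $$ (n, j) = 1" if "j \<le> n" for j
      using that n a by (auto simp: VA_entry V_entry)
    have LA: "(V_mat n * A_mat n a) $$ (n, j) = (if j = n then 2 else 1)" if "j \<le> n" for j
      using that n a by (auto simp: VA_entry V_entry)
    have pp: "proj_point n (Matrix.col (V_mat n * A_mat n a) j) = proj_point n (Matrix.col (V_mat n * ?B) j)" if j: "j \<le> n" for j
    proof -
      have c: "vec_index (Matrix.col (V_mat n * X) j) i = (V_mat n * X) $$ (i,j)" if "i \<le> n" "X \<in> carrier_mat (Suc n) (Suc n)" for i X
        using that j by (intro index_col) (auto simp: V_mat_def)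
      show ?thesis unfolding proj_point_def
        by (auto simp: fun_eq_iff c L LA j VB_entry[OF n a _ j] simp del: index_mult_mat index_col)
    qed
    have "Delta_part n a = column_simplex n (V_mat n * ?B)"
      unfolding Delta_part_def column_simplex_def
      by (intro image_cong) (auto simp: oriented_simplex_def pp)
    also have "\<dots> = {x. (\<forall>i\<ge>n. x i = 0) \<and> (\<forall>r\<le>n. 0 \<le> vec_index (?A * V_inv n *\<^sub>v homogenize n x) r)}"
      by (rule column_simplex_eq[OF VB AV 2 1 L])
    finally show ?thesis unfolding assoc_mult_mat_vec[OF B(1) V(1) homogenize_carrier] .
  qed
  have ev: "vec_index (A_inv n a 2 *\<^sub>v u) r = (if r = 0 then vec_index u a - vec_index u (1 - a) else
     if r = n then 2 * vec_index u (1 - a) else vec_index u (Suc r))"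
    if "a \<le> 1" "r \<le> n" "u \<in> carrier_vec (Suc n)" for a r u
  proof -
    have "vec_index (A_inv n a 2 *\<^sub>v u) r = (\<Sum>k<Suc n. A_inv n a 2 $$ (r,k) * vec_index u k)"
      using that by (intro mult_vec_entry) (auto simp: A_inv_def)
    also have "\<dots> = (\<Sum>k<Suc n. ((if k = (if r = 0 then a else if r = n then 1 - a else Suc r) then if r = n then 2 else 1 else 0)
       + (if k = 1 - a then if r = 0 then -1 else 0 else 0)) * vec_index u k)"
      using that n by (intro sum.cong) (auto simp: A_inv_def)
    also have "\<dots> = (if r = n then 2 else 1) * vec_index u (if r = 0 then a else if r = n then 1 - a else Suc r)
      + (if r = 0 then -1 else 0) * vec_index u (1 - a)"
      using that n by (intro row_deltas) auto
    finally show ?thesis using n by auto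
  qed
  have uc: "V_inv n *\<^sub>v homogenize n x \<in> carrier_vec (Suc n)" for x
    by (rule mult_mat_vec_carrier[OF V(1) homogenize_carrier])
  have D: "Delta n = {x. (\<forall>i\<ge>n. x i = 0) \<and> (\<forall>r\<le>n. 0 \<le> vec_index (V_inv n *\<^sub>v homogenize n x) r)}"
    unfolding Delta_def by (rule column_simplex_eq[OF matrix_carriers(1) V(1-3)]) (simp add: V_entry)
  have key: "(\<forall>r\<le>n. 0 \<le> (if r = 0 then u a - u (1 - a) else if r = n then 2 * u (1 - a) else u (Suc r)))
     \<longleftrightarrow> (\<forall>r\<le>n. 0 \<le> u r) \<and> u (1 - a) \<le> u a" if a: "a \<le> 1" for a and u :: "nat \<Rightarrow> real"
  proof
    assume L: "\<forall>r\<le>n. 0 \<le> (if r = 0 then u a - u (1 - a) else if r = n then 2 * u (1 - a) else u (Suc r))"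
    have l0: "u (1 - a) \<le> u a" using L[rule_format, of 0] by simp
    have l1: "0 \<le> u (1 - a)" using L[rule_format, of n] n by simp
    have "0 \<le> u r" if "r \<le> n" for r
    proof (cases "r \<le> 1")
      case True
      then have "r = a \<or> r = 1 - a" using a by auto
      then show ?thesis using l0 l1 by auto
    next
      case False
      then have "r - 1 \<noteq> 0" "r - 1 \<noteq> n" "Suc (r - 1) = r" "r - 1 \<le> n" using that by auto
      then show ?thesis using L[rule_format, of "r - 1"] by simp
    qed
    then show "(\<forall>r\<le>n. 0 \<le> u r) \<and> u (1 - a) \<le> u a" using l0 by blast
  next
    assume R: "(\<forall>r\<le>n. 0 \<le> u r) \<and> u (1 - a) \<le> u a"
    have "1 - a \<le> n" using n by auto
    then show "\<forall>r\<le>n. 0 \<le> (if r = 0 then u a - u (1 - a) else if r = n then 2 * u (1 - a) else u (Suc r))"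
      using R by auto
  qed
  have part: "Delta_part n a = {x \<in> Delta n. vec_index (V_inv n *\<^sub>v homogenize n x) (1 - a) \<le> vec_index (V_inv n *\<^sub>v homogenize n x) a}"
    if "a \<le> 1" for a
    unfolding eq[OF that] D using ev[OF that _ uc] key[OF that] by auto
  have z: "\<forall>i\<ge>n. x i = 0" if "x \<in> Delta n" for x using that D by auto
  have c: "vec_index (V_inv n *\<^sub>v homogenize n x) 0 = 1 - x 0"
     "vec_index (V_inv n *\<^sub>v homogenize n x) (Suc 0) = x (n - 1)" if "x \<in> Delta n" for x
    using V_inv_hom[OF n _ z[OF that]] n z[OF that] by auto
  show "Delta_part n 0 = {x \<in> Delta n. x 0 + x (n - 1) \<le> 1}"
    "Delta_part n 1 = {x \<in> Delta n. x 0 + x (n - 1) \<ge> 1}"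
    using c by (auto simp: part)
qed

lemma Delta_parts: "n \<ge> 1 \<Longrightarrow> Delta n = Delta_part n 0 \<union> Delta_part n 1"
  unfolding Delta_part_eq by auto

lemma Moenkemeyer_on_part:
  assumes "n \<ge> 1" "a \<le> 1" "x \<in> Delta_part n a"
  shows "Moenkemeyer n x = M_branch n a x"
proof -
  have "M_branch n 0 x = M_branch n 1 x" if "x \<in> Delta_part n 0" "x \<in> Delta_part n 1"
  proof -
    have "x 0 = 1 - x (n - 1)" using that unfolding Delta_part_eq[OF assms(1)] by auto
    then show ?thesis unfolding M_branch_affine[OF assms(1)] by auto
  qed
  moreover have "a = 0 \<or> a = 1" using assms by auto
  ultimately show ?thesis using assms by (auto simp: Moenkemeyer_def)
qed

lemma Tent_on_part:
  assumes "n \<ge> 1" "a \<le> 1" "x \<in> Delta_part n a"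
  shows "Tent n x = T_branch n a x"
proof -
  have "T_branch n 0 x = T_branch n 1 x" if "x \<in> Delta_part n 0" "x \<in> Delta_part n 1"
  proof -
    have "x 0 = 1 - x (n - 1)" using that unfolding Delta_part_eq[OF assms(1)] by auto
    then show ?thesis unfolding T_branch_affine[OF assms(1)] by auto
  qed
  moreover have "a = 0 \<or> a = 1" using assms by auto
  ultimately show ?thesis using assms by (auto simp: Tent_def)
qed

end

theory Submission
  imports Defs "HOL-Analysis.Uniform_Limit"
begin

text \<open>
  Both maps fold the simplex along a wall and have the same combinatorics: the inverse branches
  insert a mediant (for the Moenkemeyer map) or a midpoint (for the tent map) of the first two
  vertices. The cells of both codings shrink uniformly. Hence lifting the identity through
  corresponding inverse branches converges uniformly to a continuous semiconjugacy, which is the only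
  one respecting the two halves; exchanging the two maps yields its inverse. A homeomorphism
  commuting with the tent map preserves the wall, since the map is not locally injective there, and
  cannot swap the two halves; so it preserves the coding and is the identity.
\<close>

section \<open>Shrinking of mediant simplices\<close>

text \<open>The inverse branches of the Moenkemeyer map admit no common contraction factor. Along
  the constant word that always keeps the vertex \<open>g\<close>, the number \<open>e\<close> stays
  fixed while the denominators \<open>d\<close> of the queue grow linearly, the weight of
  \<open>g\<close> in the mediants tends to 0, and the cells shrink only at a rate of about 1/k.
  Uniform shrinking therefore combines two estimates: a geometric one while \<open>d\<close> and
  \<open>e\<close> are comparable, and a telescoping one for long runs without a switch. For the
  tent map all denominators stay 1, for the Moenkemeyer map they add up. The process only assumes
  the inequality \<open>d_step\<close>, so one argument covers both. The other obstacle is the wall,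
  where a point has two codes. Lifting could tear the map there; keeping every facet invariant
  prevents this. For uniqueness the difficulty is reversed: a homeomorphism that commutes with the
  tent map is not assumed to respect the halves, so this has to be deduced from topology
  alone.\<close>

lemma frac_mono:
  fixes x y c :: real
  assumes "0 < x" "x \<le> y" "0 \<le> c"
  shows "x / (c + x) \<le> y / (c + y)"
proof -
  have "x * (c + y) \<le> y * (c + x)" using mult_right_mono[OF assms(2,3)] by (simp add: algebra_simps)
  then show ?thesis using assms by (simp add: divide_simps)
qed

lemma inverse_power_bounds: "0 < 1 / (1 + 2 ^ (N + 1) :: real)" "1 / (1 + 2 ^ (N + 1)) \<le> (1 / 2 :: real)"
proof -
  have "(1::real) \<le> 2 ^ (N + 1)" by (rule one_le_power) simp
  then show "0 < 1 / (1 + 2 ^ (N + 1) :: real)" by simp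
  show "1 / (1 + 2 ^ (N + 1)) \<le> (1 / 2 :: real)"
    by (rule frac_le) (use \<open>(1::real) \<le> 2 ^ (N + 1)\<close> in auto)
qed

text \<open>Choose the parents of the two averages independently: the difference becomes an average
  of the four differences of parents under the product weights. One of the two pairs that contain
  \<open>y\<close> is close by a factor \<theta>, and it carries weight at least c^2; the other
  three pairs contribute at most \<delta> each.\<close>

lemma coupling:
  fixes \<omega> \<mu> x x' y y' \<delta> :: real
  assumes w: "c \<le> \<omega>" "\<omega> \<le> 1 - c" "c \<le> \<mu>" "0 \<le> c" "\<mu> \<le> 1 - c"
    and D: "\<bar>x - y\<bar> \<le> \<delta>" "\<bar>x - y'\<bar> \<le> \<delta>" "\<bar>x' - y\<bar> \<le> \<delta>" "\<bar>x' - y'\<bar> \<le> \<delta>"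
    and \<theta>: "0 \<le> \<theta>" "\<theta> \<le> 1" and C: "\<bar>x - y\<bar> \<le> \<theta> * \<delta> \<or> \<bar>x' - y\<bar> \<le> \<theta> * \<delta>"
  shows "\<bar>(\<omega> * x + (1 - \<omega>) * x') - (\<mu> * y + (1 - \<mu>) * y')\<bar> \<le> (1 - c\<^sup>2 * (1 - \<theta>)) * \<delta>"
proof -
  have \<delta>: "0 \<le> \<delta>" using D by linarith
  have key: "\<bar>A + B + C' + E\<bar> \<le> (1 - c\<^sup>2 * (1 - \<theta>)) * \<delta>"
    if "\<bar>A\<bar> \<le> wA * (\<theta> * \<delta>)" "\<bar>B\<bar> \<le> wB * \<delta>" "\<bar>C'\<bar> \<le> wC * \<delta>" "\<bar>E\<bar> \<le> wE * \<delta>"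
      "wA + wB + wC + wE = 1" "c\<^sup>2 \<le> wA" for A B C' E wA wB wC wE
  proof -
    have "\<bar>A + B + C' + E\<bar> \<le> wA * (\<theta> * \<delta>) + (wB + wC + wE) * \<delta>"
      using that by (simp add: distrib_right)
    also have "\<dots> = (1 - wA * (1 - \<theta>)) * \<delta>"
    proof -
      have "wB + wC + wE = 1 - wA" using that by simp
      then show ?thesis by (simp only:) (simp add: algebra_simps)
    qed
    also have "\<dots> \<le> (1 - c\<^sup>2 * (1 - \<theta>)) * \<delta>"
      using that(6) \<theta> \<delta> by (intro mult_right_mono diff_left_mono) auto
    finally show ?thesis .
  qed
  have nn: "0 \<le> \<omega>" "0 \<le> 1 - \<omega>" "0 \<le> \<mu>" "0 \<le> 1 - \<mu>" using w by auto
  have W: "c\<^sup>2 \<le> \<omega> * \<mu>" "c\<^sup>2 \<le> (1 - \<omega>) * \<mu>"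
    unfolding power2_eq_square using w by (auto intro!: mult_mono)
  have eq: "(\<omega> * x + (1 - \<omega>) * x') - (\<mu> * y + (1 - \<mu>) * y') =
    \<omega> * \<mu> * (x - y) + \<omega> * (1 - \<mu>) * (x - y') + (1 - \<omega>) * \<mu> * (x' - y) + (1 - \<omega>) * (1 - \<mu>) * (x' - y')"
    by (simp add: algebra_simps)
  have b: "\<bar>w * z\<bar> \<le> w * B" if "0 \<le> w" "\<bar>z\<bar> \<le> B" for w z B :: real
    using that by (simp add: abs_mult mult_left_mono)
  have nn2: "0 \<le> \<omega> * \<mu>" "0 \<le> \<omega> * (1 - \<mu>)" "0 \<le> (1 - \<omega>) * \<mu>" "0 \<le> (1 - \<omega>) * (1 - \<mu>)"
    using nn by auto
  have sum: "\<omega> * \<mu> + \<omega> * (1 - \<mu>) + (1 - \<omega>) * \<mu> + (1 - \<omega>) * (1 - \<mu>) = 1"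
    "(1 - \<omega>) * \<mu> + \<omega> * (1 - \<mu>) + \<omega> * \<mu> + (1 - \<omega>) * (1 - \<mu>) = 1"
    by (simp_all add: algebra_simps)
  from C show ?thesis
  proof
    assume C: "\<bar>x - y\<bar> \<le> \<theta> * \<delta>"
    show ?thesis unfolding eq
      by (rule key[OF b[OF nn2(1) C] b[OF nn2(2) D(2)] b[OF nn2(3) D(3)] b[OF nn2(4) D(4)] sum(1) W(1)])
  next
    assume C: "\<bar>x' - y\<bar> \<le> \<theta> * \<delta>"
    show ?thesis unfolding eq
      using key[OF b[OF nn2(3) C] b[OF nn2(2) D(2)] b[OF nn2(1) D(1)] b[OF nn2(4) D(4)] sum(2) W(2)]
      by (simp add: add.commute add.left_commute)
  qed
qed

text \<open>Vertices of a nested sequence of simplices, seen through one real coordinate: at time \<open>k\<close> the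
  current simplex has the vertex \<open>g k\<close>, followed by the queue \<open>p k, \<dots>, p (k + n - 1)\<close>, with
  denominators \<open>e\<close> and \<open>d\<close>. The mediant of \<open>g k\<close> and \<open>p k\<close> joins the end of the queue; \<open>a k\<close> tells
  which of the two is dropped.\<close>

locale mediant_process =
  fixes n :: nat and a :: "nat \<Rightarrow> bool" and e d g p :: "nat \<Rightarrow> real"
  assumes n: "n \<ge> 1"
    and e_pos: "0 < e k" and e_le_d: "e k \<le> d k" and d_Suc: "d k \<le> d (Suc k)"
    and e_Suc: "e (Suc k) = (if a k then d k else e k)"
    and d_step: "d (k + n) \<le> e k + d k"
    and g_Suc: "g (Suc k) = (if a k then p k else g k)"
    and p_step: "p (k + n) = (e k * g k + d k * p k) / (e k + d k)"
begin

definition spread_le :: "nat \<Rightarrow> real \<Rightarrow> bool" where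
  "spread_le k \<delta> \<longleftrightarrow> (\<forall>x \<in> insert (g k) (p ` {k..<k + n}). \<forall>y \<in> insert (g k) (p ` {k..<k + n}).
     \<bar>x - y\<bar> \<le> \<delta>)"

lemma d_pos: "0 < d k"
  using e_pos[of k] e_le_d[of k] by linarith

lemma d_mono: "i \<le> j \<Longrightarrow> d i \<le> d j"
  using lift_Suc_mono_le[of d] d_Suc by blast

lemma e_mono: "i \<le> j \<Longrightarrow> e i \<le> e j"
  using lift_Suc_mono_le[of e] e_Suc e_le_d by (metis order_refl)

lemma d_doubling: "d (k + m) \<le> 2 ^ m * d k"
proof (induction m)
  case (Suc m)
  have "d (k + Suc m) \<le> d (k + m + n)" using n by (intro d_mono) auto
  also have "\<dots> \<le> 2 * d (k + m)" using d_step[of "k + m"] e_le_d[of "k + m"] by simp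
  finally show ?case using Suc by simp
qed simp

lemma in_interval_step:
  assumes "x \<in> {m..M}" "y \<in> {m..M}"
  shows "(e k * x + d k * y) / (e k + d k) \<in> {m..M}"
proof -
  have b: "m * e k \<le> e k * x" "e k * x \<le> M * e k" "m * d k \<le> d k * y" "d k * y \<le> M * d k"
    using assms e_pos[of k] d_pos[of k] by (auto simp: mult.commute)
  have s: "0 < e k + d k" using e_pos[of k] d_pos[of k] by simp
  show ?thesis
    unfolding atLeastAtMost_iff pos_le_divide_eq[OF s] pos_divide_le_eq[OF s] distrib_left
    using b by linarith
qed

text \<open>Every later vertex is a current one or a mediant of two earlier ones. The induction is
  strong because \<open>p (k + i)\<close> is built from data \<open>n\<close> steps back.\<close>

lemma invariant_interval:
  assumes "g k \<in> {m..M}" and "\<And>j. j \<in> {k..<k + n} \<Longrightarrow> p j \<in> {m..M}"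
  shows "g (k + i) \<in> {m..M} \<and> p (k + i) \<in> {m..M}"
proof (induction i rule: less_induct)
  case (less i)
  have 1: "g (k + i) \<in> {m..M}"
  proof (cases i)
    case (Suc j) then show ?thesis using less[of j] g_Suc[of "k + j"] by auto
  qed (use assms in simp)
  have "p (k + i) \<in> {m..M}"
  proof (cases "i < n")
    case True then show ?thesis using assms by simp
  next
    case False
    then have "p (k + i) = p (k + (i - n) + n)" "i - n < i" using n by auto
    then show ?thesis using p_step[of "k + (i - n)"] less[of "i - n"] in_interval_step by metis
  qed
  with 1 show ?case by blast
qed

text \<open>The current vertices lie in an interval of length \<delta> starting at their minimum,
  and no later vertex leaves it. So the spread at time \<open>k\<close> controls all later times at
  once.\<close>

lemma spread_leD:
  assumes "spread_le k \<delta>" "i \<ge> k" "j \<ge> k"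
  shows "\<bar>g i - g j\<bar> \<le> \<delta>" "\<bar>g i - p j\<bar> \<le> \<delta>" "\<bar>p i - g j\<bar> \<le> \<delta>" "\<bar>p i - p j\<bar> \<le> \<delta>"
proof -
  let ?S = "insert (g k) (p ` {k..<k + n})"
  define m where "m = Min ?S"
  have fin: "finite ?S" "?S \<noteq> {}" by auto
  have "m \<in> ?S" unfolding m_def by (rule Min_in[OF fin])
  then have S: "x \<in> {m..m + \<delta>}" if "x \<in> ?S" for x
  proof -
    have "\<bar>x - m\<bar> \<le> \<delta>" using assms(1) that \<open>m \<in> ?S\<close> unfolding spread_le_def by blast
    moreover have "m \<le> x" unfolding m_def by (rule Min_le[OF fin(1) that])
    ultimately show ?thesis by auto
  qed
  have 0: "g i \<in> {m..m + \<delta>} \<and> p i \<in> {m..m + \<delta>}" if "i \<ge> k" for i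
    using invariant_interval[of k m "m + \<delta>" "i - k"] S that by auto
  show "\<bar>g i - g j\<bar> \<le> \<delta>" "\<bar>g i - p j\<bar> \<le> \<delta>" "\<bar>p i - g j\<bar> \<le> \<delta>" "\<bar>p i - p j\<bar> \<le> \<delta>"
    using 0[OF assms(2)] 0[OF assms(3)] unfolding atLeastAtMost_iff by linarith+
qed

lemma spread_le_mono:
  assumes "spread_le k \<delta>" "k \<le> l" "\<delta> \<le> \<epsilon>"
  shows "spread_le l \<epsilon>"
proof -
  have *: "\<bar>g i - g j\<bar> \<le> \<epsilon>" "\<bar>g i - p j\<bar> \<le> \<epsilon>" "\<bar>p i - g j\<bar> \<le> \<epsilon>" "\<bar>p i - p j\<bar> \<le> \<epsilon>"
    if "l \<le> i" "l \<le> j" for i j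
    using spread_leD[OF assms(1), of i j] that assms(2,3) by linarith+
  show ?thesis unfolding spread_le_def using *(1)[of l l] by (simp add: *)
qed

lemma spread_leI:
  assumes "\<And>j. j \<in> {k..<k + n} \<Longrightarrow> \<bar>g k - p j\<bar> \<le> \<delta>"
    and "\<And>i j. k \<le> i \<Longrightarrow> i < j \<Longrightarrow> j < k + n \<Longrightarrow> \<bar>p i - p j\<bar> \<le> \<delta>" and "0 \<le> \<delta>"
  shows "spread_le k \<delta>"
proof -
  have "\<bar>p i - p j\<bar> \<le> \<delta>" if "i \<in> {k..<k + n}" "j \<in> {k..<k + n}" for i j
    using that assms(2)[of i j] assms(2)[of j i] assms(3)
    by (cases i j rule: linorder_cases) (auto simp: abs_minus_commute)
  then show ?thesis
    unfolding spread_le_def using assms(1,3) by (auto simp: abs_minus_commute)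
qed

lemma g_cases: "i \<le> j \<Longrightarrow> g j = g i \<or> (\<exists>l. i \<le> l \<and> l < j \<and> g j = p l)"
proof (induction rule: dec_induct)
  case (step j)
  then show ?case using g_Suc[of j] by (metis less_Suc_eq)
qed simp

section \<open>Geometric contraction while the weights are bounded below\<close>

definition weight :: "nat \<Rightarrow> real" where "weight k = e k / (e k + d k)"

lemma p_step_weight: "p (k + n) = weight k * g k + (1 - weight k) * p k"
proof -
  have "e k + d k \<noteq> 0" using e_pos[of k] d_pos[of k] by linarith
  then have "1 - weight k = d k / (e k + d k)" unfolding weight_def by (simp add: field_simps)
  then show ?thesis unfolding p_step weight_def by (simp add: add_divide_distrib)
qed

text \<open>Of two queue entries at distance at most \<open>r + 1\<close>, their parents either share the same \<open>g\<close>, or the \<open>g\<close>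
  of the later one is a queue entry at distance at most \<open>r\<close> from the earlier one; so one round
  turns closeness at distance \<open>r\<close> into closeness at distance \<open>r + 1\<close>.\<close>

lemma close_points:
  assumes spread: "spread_le t \<delta>" and c: "0 \<le> c" "c \<le> 1"
    and w: "\<And>k. t \<le> k \<Longrightarrow> k < t + N \<Longrightarrow> c \<le> weight k \<and> weight k \<le> 1 - c"
  shows "t + r * n \<le> i \<Longrightarrow> i \<le> j \<Longrightarrow> j \<le> i + r \<Longrightarrow> j < t + N + n \<Longrightarrow> \<bar>p i - p j\<bar> \<le> (1 - c ^ (2 * r)) * \<delta>"
proof (induction r arbitrary: i j)
  case 0
  then show ?case by simp
next
  case (Suc r)
  have \<delta>: "0 \<le> \<delta>" using spread_leD(1)[OF spread, of t t] by simp
  have c2: "0 \<le> c ^ m \<and> c ^ m \<le> 1" for m using c by (simp add: power_le_one)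
  show ?case
  proof (cases "i = j")
    case True
    then show ?thesis using c2[of "2 * Suc r"] \<delta> by simp
  next
    case False
    define i' j' where "i' = i - n" and "j' = j - n"
    have i: "i = i' + n" "j = j' + n" "t + r * n \<le> i'" "i' < j'" "j' < t + N" "j' \<le> i' + Suc r"
      using Suc.prems False by (auto simp: i'_def j'_def)
    have t: "t \<le> i'" "t \<le> j'" "i' < t + N" using i by auto
    have close: "\<bar>g i' - g j'\<bar> \<le> (1 - c ^ (2 * r)) * \<delta> \<or> \<bar>p i' - g j'\<bar> \<le> (1 - c ^ (2 * r)) * \<delta>"
      using g_cases[of i' j']
    proof
      assume "g j' = g i'"
      then show ?thesis using c2[of "2 * r"] \<delta> by simp
    next
      assume "\<exists>l. i' \<le> l \<and> l < j' \<and> g j' = p l"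
      then obtain l where l: "i' \<le> l" "l < j'" "g j' = p l" by blast
      have "\<bar>p i' - p l\<bar> \<le> (1 - c ^ (2 * r)) * \<delta>" by (rule Suc.IH) (use i l in auto)
      then show ?thesis using l by simp
    qed (use i in simp)
    \<comment> \<open>With \<theta> = 1 - c^(2r), the bound of \<open>coupling\<close> is 1 - c^2 *
      c^(2r); each round multiplies the gain by c^2, whence the exponent.\<close>
    have "\<bar>p i - p j\<bar> \<le> (1 - c\<^sup>2 * (1 - (1 - c ^ (2 * r)))) * \<delta>"
      unfolding i(1,2) p_step_weight
      by (rule coupling[OF _ _ _ c(1) _ _ _ _ _ _ _ close])
        (use w[OF t(1) t(3)] w[OF t(2) i(5)] spread_leD[OF spread t(1) t(2)] c2[of "2 * r"] in auto)
    then show ?thesis by (simp add: power2_eq_square mult.assoc)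
  qed
qed

text \<open>The \<open>2 * n * n\<close> steps pay for \<open>2 * n\<close> rounds of
  \<open>close_points\<close>, which explains the exponent \<open>4 * n\<close>. The
  \<open>n\<close> further steps ensure that every queue entry \<open>j\<close> at the final time
  \<open>T\<close> has a parent time \<open>j - n\<close> after those rounds. If \<open>g\<close> is
  unchanged from then to \<open>T\<close>, the mediant step itself moved \<open>p j\<close> towards
  it with weight at least c; otherwise \<open>g T\<close> is a queue entry adopted since, and
  \<open>close_points\<close> applies to it.\<close>

lemma contraction:
  assumes spread: "spread_le t \<delta>" and c: "0 < c" "c \<le> 1"
    and w: "\<And>k. t \<le> k \<Longrightarrow> k < t + (2 * n * n + n) \<Longrightarrow> c \<le> weight k \<and> weight k \<le> 1 - c"
  shows "spread_le (t + (2 * n * n + n)) ((1 - c ^ (4 * n)) * \<delta>)"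
proof -
  define T where "T = t + (2 * n * n + n)"
  define \<theta> where "\<theta> = 1 - c ^ (4 * n)"
  have \<delta>: "0 \<le> \<delta>" using spread_leD(1)[OF spread, of t t] by simp
  have cp: "0 \<le> \<theta>" "1 - c \<le> \<theta>"
    using c n power_decreasing[of 1 "4 * n" c] by (auto simp: \<theta>_def power_le_one)
  have close: "\<bar>p i - p j\<bar> \<le> \<theta> * \<delta>" if "t + 2 * n * n \<le> i" "i \<le> j" "j \<le> i + 2 * n" "j < T + n" for i j
    using close_points[where N="2 * n * n + n" and r="2 * n" and i=i and j=j, OF spread _ c(2) w] c(1) that
    by (auto simp: \<theta>_def T_def)
  have "spread_le T (\<theta> * \<delta>)"
  proof (rule spread_leI)
    fix j assume j: "j \<in> {T..<T + n}"
    define j' where "j' = j - n"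
    have j': "j = j' + n" "t + 2 * n * n \<le> j'" "j' < T" "t \<le> j'"
      using j by (auto simp: j'_def T_def)
    from g_cases[of j' T] show "\<bar>g T - p j\<bar> \<le> \<theta> * \<delta>"
    proof
      assume G: "g T = g j'"
      have "g T - p j = (1 - weight j') * (g j' - p j')"
        unfolding G j'(1) p_step_weight by (simp add: algebra_simps)
      moreover have "0 \<le> 1 - weight j'" "1 - weight j' \<le> \<theta>"
        using w[of j'] j' c cp by (auto simp: T_def)
      ultimately show ?thesis using spread_leD(2)[OF spread j'(4,4)] \<delta>
        by (auto simp: abs_mult intro!: mult_mono)
    next
      assume "\<exists>l\<ge>j'. l < T \<and> g T = p l"
      then obtain l where l: "j' \<le> l" "l < T" "g T = p l" by blast
      show ?thesis unfolding l(3) by (rule close) (use l j j' in \<open>auto simp: T_def\<close>)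
    qed (use j' in simp)
  next
    fix i j assume "T \<le> i" "i < j" "j < T + n"
    then show "\<bar>p i - p j\<bar> \<le> \<theta> * \<delta>" by (intro close) (auto simp: T_def)
  qed (use \<delta> cp in simp)
  then show ?thesis unfolding T_def \<theta>_def .
qed

section \<open>Contraction along runs without a switch\<close>

lemma constant_run:
  assumes "\<And>k. s \<le> k \<Longrightarrow> k < t \<Longrightarrow> \<not> a k" and "s \<le> k" "k \<le> t"
  shows "g k = g s \<and> e k = e s"
  using assms(2,3)
proof (induction rule: dec_induct)
  case (step k)
  then show ?case using assms(1)[of k] g_Suc[of k] e_Suc[of k] by simp
qed simp

text \<open>While \<open>g\<close> and \<open>e\<close> are constant, each residue class of times
  modulo \<open>n\<close> evolves separately: \<open>d\<close> grows at most by \<open>e\<close> per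
  round, and the distance of \<open>p\<close> from \<open>g\<close> is multiplied by
  \<open>d / (e + d)\<close>. The product of these factors telescopes and decays like 1/J. The
  factor 2 is the triangle inequality through \<open>g\<close>.\<close>

lemma run_contraction:
  assumes spread: "spread_le s \<delta>" and run: "\<And>k. s \<le> k \<Longrightarrow> k < s + J * n \<Longrightarrow> \<not> a k"
    and R: "d s \<le> R * e s"
  shows "spread_le (s + J * n) (2 * (\<delta> * (2 ^ n * R / (2 ^ n * R + real J))))"
proof -
  have \<delta>: "0 \<le> \<delta>" using spread_leD(1)[OF spread, of s s] by simp
  define G E where "G = g s" and "E = e s"
  have GE: "g k = G \<and> e k = E" if "s \<le> k" "k \<le> s + J * n" for k
    unfolding G_def E_def by (rule constant_run[OF run]) (use that in auto)
  have E: "0 < E" unfolding E_def by (rule e_pos)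
  have "0 < R * E" using R E d_pos[of s] unfolding E_def by linarith
  then have Rp: "0 < R" using E by (simp add: zero_less_mult_iff)
  have lin: "d (k + j * n) \<le> d k + real j * E \<and> \<bar>p (k + j * n) - G\<bar> \<le> \<delta> * (d k / (d k + real j * E))"
    if k: "s \<le> k" "k < s + n" and "j \<le> J" for k j
    using that(3)
  proof (induction j)
    case 0
    then show ?case using spread_leD(3)[OF spread, of k s] k d_pos[of k] by (simp add: G_def)
  next
    case (Suc j)
    define l where "l = k + j * n"
    have IH: "d l \<le> d k + real j * E" "\<bar>p l - G\<bar> \<le> \<delta> * (d k / (d k + real j * E))"
      using Suc by (auto simp: l_def)
    have "l < s + (j + 1) * n" using k by (simp add: l_def)
    also have "\<dots> \<le> s + J * n" using Suc.prems by (intro add_left_mono mult_right_mono) auto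
    finally have l: "g l = G" "e l = E" using GE[of l] k by (auto simp: l_def)
    have Sl: "k + Suc j * n = l + n" by (simp add: l_def)
    have p: "d k > 0" "d l > 0" using d_pos by auto
    have jE: "0 \<le> real j * E" using E by simp
    have "p (l + n) - G = d l / (E + d l) * (p l - G)"
      unfolding p_step l using p E by (simp add: field_simps)
    then have "\<bar>p (l + n) - G\<bar> = d l / (E + d l) * \<bar>p l - G\<bar>" using p E by (simp add: abs_mult)
    \<comment> \<open>The factor increases with \<open>d l\<close>, so the linear upper bound may
      replace \<open>d l\<close>; its numerator then cancels the denominator from the previous
      round.\<close>
    also have "\<dots> \<le> (d k + real j * E) / (E + (d k + real j * E)) * (\<delta> * (d k / (d k + real j * E)))"
    proof (rule mult_mono)
      show "d l / (E + d l) \<le> (d k + real j * E) / (E + (d k + real j * E))"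
        using IH(1) p(2) E by (intro frac_mono) auto
      show "0 \<le> (d k + real j * E) / (E + (d k + real j * E))" using p E jE by simp
    qed (use IH(2) in auto)
    also have "\<dots> = \<delta> * (d k / (d k + real (Suc j) * E))"
    proof -
      have "d k + real j * E \<noteq> 0" using p jE by linarith
      moreover have "E + (d k + real j * E) = d k + real (Suc j) * E" by (simp add: algebra_simps)
      moreover have "x / y * (\<delta> * (z / x)) = \<delta> * (z / y)" if "x \<noteq> 0" for x y z :: real
        using that by simp
      ultimately show ?thesis by metis
    qed
    finally have "\<bar>p (l + n) - G\<bar> \<le> \<delta> * (d k / (d k + real (Suc j) * E))" .
    moreover have "d (l + n) \<le> d k + real (Suc j) * E"
      using d_step[of l] IH(1) unfolding l by (simp add: algebra_simps)
    ultimately show ?case unfolding Sl by blast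
  qed
  define \<eta> where "\<eta> = \<delta> * (2 ^ n * R / (2 ^ n * R + real J))"
  have \<eta>: "0 \<le> \<eta>" using \<delta> Rp by (simp add: \<eta>_def)
  have near: "\<bar>p i - G\<bar> \<le> \<eta>" if i: "s + J * n \<le> i" "i < s + J * n + n" for i
  proof -
    define k where "k = i - J * n"
    have k: "i = k + J * n" "s \<le> k" "k < s + n" using i by (auto simp: k_def)
    \<comment> \<open>The starting times of the residue classes lie less than \<open>n\<close> steps
      after \<open>s\<close>, so \<open>n\<close> doublings bound their denominators; this is the
      origin of \<open>2 ^ n * R\<close>.\<close>
    have "d k \<le> d (s + n)" using k by (intro d_mono) auto
    also have "\<dots> \<le> 2 ^ n * d s" by (rule d_doubling)
    also have "\<dots> \<le> 2 ^ n * R * E" using R by (simp add: E_def)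
    finally have dk: "d k \<le> 2 ^ n * R * E" .
    have "d k / (d k + real J * E) \<le> (2 ^ n * R * E) / (2 ^ n * R * E + real J * E)"
      using frac_mono[OF d_pos dk, of "real J * E"] E by (simp add: add.commute)
    also have "\<dots> = (2 ^ n * R * E) / ((2 ^ n * R + real J) * E)" by (simp add: algebra_simps)
    also have "\<dots> = 2 ^ n * R / (2 ^ n * R + real J)" using E by simp
    finally have "\<delta> * (d k / (d k + real J * E)) \<le> \<eta>" unfolding \<eta>_def by (rule mult_left_mono) (rule \<delta>)
    then show ?thesis using lin[OF k(2,3), of J] k(1) by simp
  qed
  have "spread_le (s + J * n) (2 * \<eta>)"
  proof (rule spread_leI)
    fix j assume "j \<in> {s + J * n..<s + J * n + n}"
    then show "\<bar>g (s + J * n) - p j\<bar> \<le> 2 * \<eta>" using near[of j] GE[of "s + J * n"] \<eta> by auto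
  next
    fix i j assume "s + J * n \<le> i" "i < j" "j < s + J * n + n"
    then show "\<bar>p i - p j\<bar> \<le> 2 * \<eta>" using near[of i] near[of j] by auto
  qed (use \<eta> in simp)
  then show ?thesis unfolding \<eta>_def .
qed

text \<open>\<open>e\<close> never decreases and \<open>d\<close> at most doubles per step, so
  \<open>d / e\<close> stays below 2^(N+1). The upper bound is easier: \<open>e \<le> d\<close>
  makes every weight at most 1/2.\<close>

lemma weight_bounds:
  assumes "d t \<le> 2 * e t" "t \<le> k" "k < t + N"
  shows "1 / (1 + 2 ^ (N + 1)) \<le> weight k" "weight k \<le> 1 - 1 / (1 + 2 ^ (N + 1))"
proof -
  have "d k \<le> d (t + N)" using assms by (intro d_mono) auto
  also have "\<dots> \<le> 2 ^ N * d t" by (rule d_doubling)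
  also have "\<dots> \<le> 2 ^ N * (2 * e t)" using assms by simp
  also have "\<dots> \<le> 2 ^ N * (2 * e k)" using e_mono[OF assms(2)] by simp
  finally have "d k \<le> 2 ^ (N + 1) * e k" by simp
  then have "e k + d k \<le> (1 + 2 ^ (N + 1)) * e k" by (simp add: algebra_simps)
  then have "e k / ((1 + 2 ^ (N + 1)) * e k) \<le> e k / (e k + d k)"
    using e_pos[of k] d_pos[of k] by (intro divide_left_mono mult_pos_pos add_pos_pos) auto
  then show "1 / (1 + 2 ^ (N + 1)) \<le> weight k" unfolding weight_def using e_pos[of k] by simp
  have "weight k \<le> 1 / 2"
    unfolding weight_def using e_pos[of k] e_le_d[of k] by (simp add: field_simps)
  then show "weight k \<le> 1 - 1 / (1 + 2 ^ (N + 1))" using inverse_power_bounds(2)[of N] by linarith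
qed

text \<open>The condition \<open>d t \<le> 2 * e t\<close> holds initially and just after every switch; it bounds the weights from
  below during the next \<open>N\<close> steps, which then contract by a fixed factor. Afterwards either a switch
  comes soon, or a long run without switch contracts on its own.\<close>

lemma spread_after_switches:
  fixes N :: nat and J :: nat
  defines "N \<equiv> 2 * n * n + n"
  assumes J: "2 * (\<delta> * (2 ^ n * 2 ^ (N + 1) / (2 ^ n * 2 ^ (N + 1) + real J))) \<le> \<epsilon>"
    and "spread_le t ((1 - (1 / (1 + 2 ^ (N + 1))) ^ (4 * n)) ^ i * \<delta>)" and "0 \<le> \<delta>"
    and "d t \<le> 2 * e t"
  shows "spread_le (t + m * (N + J * n + 1)) (max \<epsilon> ((1 - (1 / (1 + 2 ^ (N + 1))) ^ (4 * n)) ^ (i + m) * \<delta>))"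
  using assms(3,5)
proof (induction m arbitrary: t i)
  case 0
  then show ?case using spread_le_mono[OF 0(1), of t] by simp
next
  case (Suc m)
  let ?c = "1 / (1 + 2 ^ (N + 1)) :: real"
  let ?\<theta> = "1 - ?c ^ (4 * n)"
  have c: "0 < ?c" "?c \<le> 1" using inverse_power_bounds[of N] by linarith+
  then have \<theta>: "0 \<le> ?\<theta>" "?\<theta> \<le> 1" by (auto simp: power_le_one)
  have N: "spread_le (t + N) (?\<theta> * (?\<theta> ^ i * \<delta>))"
    unfolding N_def
    by (rule contraction[OF Suc.prems(1)[unfolded N_def] c[unfolded N_def]])
      (use weight_bounds[OF Suc.prems(2), where N=N] in \<open>auto simp: N_def\<close>)
  show ?case
  proof (cases "\<exists>k. t + N \<le> k \<and> k < t + N + J * n \<and> a k")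
    case True
    then obtain k where k: "t + N \<le> k" "k < t + N + J * n" "a k" by blast
    have "spread_le (Suc k) (?\<theta> ^ Suc i * \<delta>)" using spread_le_mono[OF N] k by (simp add: mult.assoc)
    \<comment> \<open>At a switch \<open>e\<close> takes the value \<open>d k\<close>, so one
      doubling of \<open>d\<close> restores the condition for the next round.\<close>
    moreover have "d (Suc k) \<le> 2 * e (Suc k)"
      using e_Suc[of k] k d_doubling[of k 1] by simp
    ultimately have "spread_le (Suc k + m * (N + J * n + 1)) (max \<epsilon> (?\<theta> ^ (Suc i + m) * \<delta>))"
      by (rule Suc.IH)
    then show ?thesis by (rule spread_le_mono) (use k in auto)
  next
    case False
    have "d (t + N) \<le> 2 ^ N * d t" by (rule d_doubling)
    also have "\<dots> \<le> 2 ^ N * (2 * e t)" using Suc.prems by simp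
    also have "\<dots> \<le> 2 ^ N * (2 * e (t + N))" using e_mono[of t "t + N"] by simp
    finally have R: "d (t + N) \<le> 2 ^ (N + 1) * e (t + N)" by simp
    \<comment> \<open>The progress made so far is given up here, so that the same \<open>J\<close>
      serves in every round.\<close>
    have "?\<theta> * (?\<theta> ^ i * \<delta>) \<le> 1 * \<delta>" unfolding mult.assoc[symmetric]
      using \<theta> assms(4) by (intro mult_right_mono mult_le_one power_le_one) auto
    then have "spread_le (t + N) \<delta>" using spread_le_mono[OF N, of "t + N" \<delta>] by simp
    from run_contraction[OF this _ R, of J] False J
    have "spread_le (t + N + J * n) \<epsilon>" using spread_le_mono by blast
    then show ?thesis by (rule spread_le_mono) auto
  qed
qed

end

text \<open>\<open>K\<close> consists of \<open>m\<close> rounds of \<open>N + J * n + 1\<close>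
  steps: \<open>J\<close> brings the run estimate below \<epsilon>, and \<open>m\<close> the
  geometric factor. Neither choice looks at the process, so the bound is uniform over all switching
  sequences.\<close>

lemma mediant_process_spread:
  assumes n: "n \<ge> 1" and "0 \<le> \<delta>" and "0 < \<epsilon>"
  obtains K where "\<And>a e d g p k. mediant_process n a e d g p \<Longrightarrow> mediant_process.spread_le n g p 0 \<delta> \<Longrightarrow>
    d 0 \<le> 2 * e 0 \<Longrightarrow> K \<le> k \<Longrightarrow> mediant_process.spread_le n g p k \<epsilon>"
proof -
  define N where "N = 2 * n * n + n"
  define R where "R = (2 ^ n * 2 ^ (N + 1) :: real)"
  define \<theta> where "\<theta> = 1 - (1 / (1 + 2 ^ (N + 1)) :: real) ^ (4 * n)"
  have R: "0 < R" by (simp add: R_def)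
  obtain J :: nat where J: "2 * \<delta> * R / \<epsilon> < real J" using reals_Archimedean2 by blast
  have J': "2 * (\<delta> * (2 ^ n * 2 ^ (N + 1) / (2 ^ n * 2 ^ (N + 1) + real J))) \<le> \<epsilon>"
  proof -
    have "2 * \<delta> * R < real J * \<epsilon>" using J assms(3) by (simp add: field_simps)
    then have "2 * (\<delta> * R) \<le> \<epsilon> * (R + real J)" using R assms by (simp add: algebra_simps)
      (smt (verit) mult_pos_pos)
    then show ?thesis unfolding R_def[symmetric] using R by (simp add: field_simps)
  qed
  define c where "c = 1 / (1 + 2 ^ (N + 1) :: real)"
  have "0 < c" "c \<le> 1" using inverse_power_bounds[of N] unfolding c_def by linarith+
  then have "0 < c ^ (4 * n)" "c ^ (4 * n) \<le> 1" by (auto intro: power_le_one)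
  then have \<theta>: "0 \<le> \<theta>" "\<theta> < 1" unfolding \<theta>_def c_def[symmetric] by auto
  have "(\<lambda>m. \<theta> ^ m * \<delta>) \<longlonglongrightarrow> 0 * \<delta>" using \<theta> by (intro tendsto_mult LIMSEQ_power_zero tendsto_const) auto
  then have "\<forall>\<^sub>F m in sequentially. \<theta> ^ m * \<delta> < \<epsilon>" using assms(3) by (intro order_tendstoD) auto
  then obtain m where m: "\<theta> ^ m * \<delta> < \<epsilon>" by (auto simp: eventually_sequentially)
  show ?thesis
  proof (rule that[of "m * (N + J * n + 1)"])
    fix a e d g p k
    assume "mediant_process n a e d g p" and s: "mediant_process.spread_le n g p 0 \<delta>"
      and de: "d 0 \<le> 2 * e 0" and k: "m * (N + J * n + 1) \<le> k"
    then interpret mediant_process n a e d g p by blast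
    have "spread_le (0 + m * (N + J * n + 1)) (max \<epsilon> (\<theta> ^ (0 + m) * \<delta>))"
      unfolding \<theta>_def N_def
      by (rule spread_after_switches[OF J'[unfolded N_def]]) (use s de assms in auto)
    then show "spread_le k \<epsilon>" by (rule spread_le_mono) (use k m in auto)
  qed
qed

section \<open>Folding maps in barycentric coordinates\<close>

text \<open>In barycentric coordinates with respect to the vertices of the simplex, both maps take the
  homogeneous form \<open>fold_raw\<close>: the Moenkemeyer map for \<open>c = 1\<close> and the tent map for \<open>c = 1 / 2\<close>. The
  inverse branches are \<open>unfold_raw\<close>, with \<open>a\<close> true for the branch onto \<open>x 0 \<le> x 1\<close>.\<close>

definition normalize_sum :: "nat \<Rightarrow> (nat \<Rightarrow> real) \<Rightarrow> nat \<Rightarrow> real" where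
  "normalize_sum n y = (\<lambda>j. y j / (\<Sum>i\<le>n. y i))"

definition fold_raw :: "nat \<Rightarrow> real \<Rightarrow> (nat \<Rightarrow> real) \<Rightarrow> nat \<Rightarrow> real" where
  "fold_raw n c x = (\<lambda>j. if j = 0 then \<bar>x 0 - x 1\<bar> else if j < n then x (Suc j)
     else if j = n then min (x 0) (x 1) / c else 0)"

definition unfold_raw :: "nat \<Rightarrow> real \<Rightarrow> bool \<Rightarrow> (nat \<Rightarrow> real) \<Rightarrow> nat \<Rightarrow> real" where
  "unfold_raw n c a y = (\<lambda>j. if j = 0 then c * y n + (if a then 0 else y 0)
     else if j = 1 then c * y n + (if a then y 0 else 0)
     else if j \<le> n then y (j - 1) else 0)"

definition fold_map :: "nat \<Rightarrow> real \<Rightarrow> (nat \<Rightarrow> real) \<Rightarrow> nat \<Rightarrow> real" where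
  "fold_map n c x = normalize_sum n (fold_raw n c x)"

definition unfold_map :: "nat \<Rightarrow> real \<Rightarrow> bool \<Rightarrow> (nat \<Rightarrow> real) \<Rightarrow> nat \<Rightarrow> real" where
  "unfold_map n c a y = normalize_sum n (unfold_raw n c a y)"

text \<open>The transpose of \<open>unfold_raw\<close>: iterating it on a linear functional yields the values of that
  functional at the vertices of the successive cells.\<close>

definition dual_step :: "nat \<Rightarrow> real \<Rightarrow> bool \<Rightarrow> (nat \<Rightarrow> real) \<Rightarrow> nat \<Rightarrow> real" where
  "dual_step n c a l = (\<lambda>j. if j = 0 then l (if a then 1 else 0) else if j < n then l (Suc j)
     else c * (l 0 + l 1))"

lemma sum_unfold_raw:
  assumes "n \<ge> 1"
  shows "(\<Sum>j\<le>n. unfold_raw n c a y j * l j) = (\<Sum>j\<le>n. y j * dual_step n c a l j)"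
proof -
  obtain m where m: "n = Suc m" using assms by (cases n) auto
  have "(\<Sum>j\<le>n. unfold_raw n c a y j * l j) =
      unfold_raw n c a y 0 * l 0 + (unfold_raw n c a y 1 * l 1 + (\<Sum>j<m. y (Suc j) * l (Suc (Suc j))))"
    unfolding m lessThan_Suc_atMost[symmetric] sum.lessThan_Suc_shift
    by (simp add: unfold_raw_def)
  also have "\<dots> = y 0 * l (if a then 1 else 0) + ((\<Sum>j<m. y (Suc j) * l (Suc (Suc j))) + y n * (c * (l 0 + l 1)))"
    by (simp add: unfold_raw_def algebra_simps)
  also have "\<dots> = (\<Sum>j\<le>n. y j * dual_step n c a l j)"
  proof -
    have "(\<Sum>j\<le>n. y j * dual_step n c a l j) = y 0 * dual_step n c a l 0 +
       ((\<Sum>j<m. y (Suc j) * dual_step n c a l (Suc j)) + y (Suc m) * dual_step n c a l (Suc m))"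
      unfolding m lessThan_Suc_atMost[symmetric] sum.lessThan_Suc_shift[of _ "Suc m"] sum.lessThan_Suc[of _ m] ..
    also have "(\<Sum>j<m. y (Suc j) * dual_step n c a l (Suc j)) = (\<Sum>j<m. y (Suc j) * l (Suc (Suc j)))"
      by (rule sum.cong) (auto simp: dual_step_def m)
    finally show ?thesis by (simp add: dual_step_def m)
  qed
  finally show ?thesis .
qed

lemma sum_unfold_raw_total:
  assumes "n \<ge> 1"
  shows "(\<Sum>j\<le>n. unfold_raw n c a y j) = (\<Sum>j\<le>n. y j) + (2 * c - 1) * y n"
proof -
  have "(\<Sum>j\<le>n. unfold_raw n c a y j) = (\<Sum>j\<le>n. y j * dual_step n c a (\<lambda>_. 1) j)"
    using sum_unfold_raw[OF assms, of c a y "\<lambda>_. 1"] by simp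
  also have "\<dots> = (\<Sum>j\<le>n. y j + (if j = n then (2 * c - 1) * y n else 0))"
    using assms by (intro sum.cong) (auto simp: dual_step_def algebra_simps)
  finally show ?thesis by (simp add: sum.distrib)
qed

text \<open>Folding replaces \<open>x 0 + x 1\<close>, which is the absolute difference plus twice
  the minimum, by the absolute difference plus \<open>1 / c\<close> times the minimum. For c = 1/2
  the correction vanishes: the tent map needs no normalization and is affine on each half.\<close>

lemma sum_fold_raw:
  assumes "n \<ge> 1"
  shows "(\<Sum>j\<le>n. fold_raw n c x j) = (\<Sum>j\<le>n. x j) + (1 / c - 2) * min (x 0) (x 1)"
proof -
  obtain m where m: "n = Suc m" using assms by (cases n) auto
  have "(\<Sum>j\<le>n. fold_raw n c x j) = fold_raw n c x 0 +
       ((\<Sum>j<m. fold_raw n c x (Suc j)) + fold_raw n c x (Suc m))"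
    unfolding m lessThan_Suc_atMost[symmetric] sum.lessThan_Suc_shift[of _ "Suc m"] sum.lessThan_Suc[of _ m] ..
  also have "(\<Sum>j<m. fold_raw n c x (Suc j)) = (\<Sum>j<m. x (Suc (Suc j)))"
    by (rule sum.cong) (auto simp: fold_raw_def m)
  finally have 1: "(\<Sum>j\<le>n. fold_raw n c x j) =
     \<bar>x 0 - x 1\<bar> + ((\<Sum>j<m. x (Suc (Suc j))) + min (x 0) (x 1) / c)"
    by (simp add: fold_raw_def m)
  have 2: "(\<Sum>j\<le>n. x j) = x 0 + (x 1 + (\<Sum>j<m. x (Suc (Suc j))))"
    unfolding m lessThan_Suc_atMost[symmetric] sum.lessThan_Suc_shift by simp
  have "x 0 + x 1 = \<bar>x 0 - x 1\<bar> + 2 * min (x 0) (x 1)" by (simp add: min_def abs_if)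
  then show ?thesis unfolding 1 2 by (simp add: algebra_simps)
qed

lemma normalize_sum_scale:
  assumes "k \<noteq> 0"
  shows "normalize_sum n (\<lambda>j. k * y j) = normalize_sum n y"
  unfolding normalize_sum_def sum_distrib_left[symmetric] using assms by simp

lemma normalize_sum_simplex: "y \<in> standard_simplex n \<Longrightarrow> normalize_sum n y = y"
  by (simp add: normalize_sum_def standard_simplex_def)

lemma normalize_sum_eq_scale: "normalize_sum n y = (\<lambda>j. 1 / (\<Sum>i\<le>n. y i) * y j)"
  by (simp add: normalize_sum_def)

lemma in_standard_simplexI:
  assumes "\<And>j. 0 \<le> y j" "\<And>j. j > n \<Longrightarrow> y j = 0" "(\<Sum>j\<le>n. y j) = 1"
  shows "y \<in> standard_simplex n"
proof -
  have "y j \<le> 1" for j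
  proof (cases "j \<le> n")
    case True
    then have "y j \<le> (\<Sum>j\<le>n. y j)" using assms(1) by (intro member_le_sum) auto
    then show ?thesis using assms by simp
  qed (use assms in simp)
  then show ?thesis using assms by (auto simp: standard_simplex_def)
qed

lemma normalize_sum_in_simplex:
  assumes "\<And>j. 0 \<le> y j" "\<And>j. j > n \<Longrightarrow> y j = 0" "0 < (\<Sum>j\<le>n. y j)"
  shows "normalize_sum n y \<in> standard_simplex n"
  using assms
  by (intro in_standard_simplexI) (auto simp: normalize_sum_def sum_divide_distrib[symmetric])

lemma simplexD:
  assumes "x \<in> standard_simplex n"
  shows "0 \<le> x j" "x j \<le> 1" "j > n \<Longrightarrow> x j = 0" "(\<Sum>i\<le>n. x i) = 1"
  using assms by (auto simp: standard_simplex_def)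

lemma fold_unfold_raw:
  assumes "n \<ge> 1" "c > 0" "\<And>j. 0 \<le> y j" "\<And>j. j > n \<Longrightarrow> y j = 0"
  shows "fold_raw n c (unfold_raw n c a y) = y"
proof
  fix j
  have "\<bar>unfold_raw n c a y 0 - unfold_raw n c a y 1\<bar> = y 0"
    "min (unfold_raw n c a y 0) (unfold_raw n c a y 1) = c * y n"
    using assms(3)[of 0] by (auto simp: unfold_raw_def)
  then show "fold_raw n c (unfold_raw n c a y) j = y j"
    unfolding fold_raw_def using assms by (auto simp: unfold_raw_def)
qed

lemma unfold_fold_raw:
  assumes "n \<ge> 1" "c > 0" "\<And>j. j > n \<Longrightarrow> x j = 0" "a \<Longrightarrow> x 0 \<le> x 1" "\<not> a \<Longrightarrow> x 1 \<le> x 0"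
  shows "unfold_raw n c a (fold_raw n c x) = x"
proof
  fix j show "unfold_raw n c a (fold_raw n c x) j = x j"
    using assms by (cases a) (auto simp: fold_raw_def unfold_raw_def min_def)
qed

lemma fold_raw_scale: "0 \<le> k \<Longrightarrow> fold_raw n c (\<lambda>j. k * x j) = (\<lambda>j. k * fold_raw n c x j)"
  by (auto simp: fold_raw_def fun_eq_iff min_mult_distrib_left abs_mult right_diff_distrib[symmetric])

lemma unfold_raw_scale: "unfold_raw n c a (\<lambda>j. k * y j) = (\<lambda>j. k * unfold_raw n c a y j)"
  by (auto simp: unfold_raw_def fun_eq_iff algebra_simps)

lemma min_simplex_le_half:
  assumes "n \<ge> 1" "x \<in> standard_simplex n"
  shows "min (x 0) (x 1) \<le> 1 / 2"
proof -
  have "(\<Sum>i\<in>{0, 1}. x i) \<le> (\<Sum>i\<le>n. x i)"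
    using assms simplexD(1)[OF assms(2)] by (intro sum_mono2) auto
  then show ?thesis using simplexD(4)[OF assms(2)] by simp
qed

text \<open>Both quotients are averages of the ratios \<open>l j / d j\<close>, with weights
  proportional to \<open>y j * d j\<close> and \<open>y' j * d j\<close>, so both lie between the
  least ratio and that ratio plus \<epsilon>.\<close>

lemma weighted_average_close:
  fixes y y' r :: "nat \<Rightarrow> real"
  assumes y: "y \<in> standard_simplex n" "y' \<in> standard_simplex n"
    and d: "\<And>j. j \<le> n \<Longrightarrow> 0 < d j"
    and r: "\<And>i j. i \<le> n \<Longrightarrow> j \<le> n \<Longrightarrow> \<bar>l i / d i - l j / d j\<bar> \<le> \<epsilon>"
  shows "\<bar>(\<Sum>j\<le>n. y j * l j) / (\<Sum>j\<le>n. y j * d j) - (\<Sum>j\<le>n. y' j * l j) / (\<Sum>j\<le>n. y' j * d j)\<bar> \<le> \<epsilon>"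
proof -
  define m where "m = Min ((\<lambda>j. l j / d j) ` {..n})"
  have "m \<in> (\<lambda>j. l j / d j) ` {..n}" unfolding m_def by (rule Min_in) auto
  then have lj: "m * d j \<le> l j" "l j \<le> (m + \<epsilon>) * d j" if "j \<le> n" for j
  proof -
    obtain i where i: "i \<le> n" "m = l i / d i" using \<open>m \<in> _\<close> by auto
    have "m \<le> l j / d j" unfolding m_def by (rule Min_le) (use that in auto)
    moreover have "l j / d j \<le> m + \<epsilon>" using r[OF that i(1)] i(2) by linarith
    ultimately show "m * d j \<le> l j" "l j \<le> (m + \<epsilon>) * d j"
      using d[OF that] by (auto simp: field_simps)
  qed
  have I: "m \<le> (\<Sum>j\<le>n. y j * l j) / (\<Sum>j\<le>n. y j * d j)" "(\<Sum>j\<le>n. y j * l j) / (\<Sum>j\<le>n. y j * d j) \<le> m + \<epsilon>"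
    if y: "y \<in> standard_simplex n" for y
  proof -
    have "\<exists>i\<in>{..n}. y i \<noteq> 0"
      using simplexD(4)[OF y] by (metis sum.neutral zero_neq_one)
    then obtain i where i: "i \<le> n" "0 < y i" using simplexD(1)[OF y] by (metis atMost_iff order_less_le)
    have "0 < y i * d i" using i d by simp
    also have "\<dots> \<le> (\<Sum>j\<le>n. y j * d j)"
      using i d simplexD(1)[OF y] by (intro member_le_sum) (auto simp: less_imp_le)
    finally have P: "0 < (\<Sum>j\<le>n. y j * d j)" .
    have "m * (\<Sum>j\<le>n. y j * d j) = (\<Sum>j\<le>n. y j * (m * d j))" by (simp add: sum_distrib_left mult.left_commute)
    also have "\<dots> \<le> (\<Sum>j\<le>n. y j * l j)" using lj simplexD(1)[OF y] by (intro sum_mono mult_left_mono) auto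
    finally show "m \<le> (\<Sum>j\<le>n. y j * l j) / (\<Sum>j\<le>n. y j * d j)" using P by (simp add: pos_le_divide_eq)
    have "(\<Sum>j\<le>n. y j * l j) \<le> (\<Sum>j\<le>n. y j * ((m + \<epsilon>) * d j))"
      using lj simplexD(1)[OF y] by (intro sum_mono mult_left_mono) auto
    also have "\<dots> = (m + \<epsilon>) * (\<Sum>j\<le>n. y j * d j)" by (simp add: sum_distrib_left mult.left_commute)
    finally show "(\<Sum>j\<le>n. y j * l j) / (\<Sum>j\<le>n. y j * d j) \<le> m + \<epsilon>" using P by (simp add: pos_divide_le_eq)
  qed
  from I[OF y(1)] I[OF y(2)] show ?thesis by linarith
qed

text \<open>The endpoints of the range of \<open>c\<close> are the tent and the Moenkemeyer map. The
  lower bound makes denominators nondecreasing along the vertices; the upper bound keeps a new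
  denominator below the sum of its parents.\<close>

locale folding =
  fixes n :: nat and c :: real
  assumes n: "n \<ge> 1" and c: "1 / 2 \<le> c" "c \<le> 1"
begin

lemma sum_fold_raw_pos: "x \<in> standard_simplex n \<Longrightarrow> 1 / 2 \<le> (\<Sum>j\<le>n. fold_raw n c x j)"
proof -
  assume x: "x \<in> standard_simplex n"
  have "-1 \<le> 1 / c - 2" using c by (simp add: field_simps)
  then have "-1 * min (x 0) (x 1) \<le> (1 / c - 2) * min (x 0) (x 1)"
    using simplexD(1)[OF x] by (intro mult_right_mono) auto
  then show ?thesis
    unfolding sum_fold_raw[OF n] using min_simplex_le_half[OF n x] simplexD(4)[OF x] by linarith
qed

lemma sum_unfold_raw_pos: "y \<in> standard_simplex n \<Longrightarrow> 1 \<le> (\<Sum>j\<le>n. unfold_raw n c a y j)"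
  unfolding sum_unfold_raw_total[OF n] using c simplexD[of y n] by simp

lemma fold_map_in: "x \<in> standard_simplex n \<Longrightarrow> fold_map n c x \<in> standard_simplex n"
  unfolding fold_map_def using sum_fold_raw_pos[of x] simplexD(1)[of x n] c
  by (intro normalize_sum_in_simplex) (auto simp: fold_raw_def)

lemma unfold_map_in: "y \<in> standard_simplex n \<Longrightarrow> unfold_map n c a y \<in> standard_simplex n"
  unfolding unfold_map_def using sum_unfold_raw_pos[of y a] simplexD(1)[of y n] c n
  by (intro normalize_sum_in_simplex) (auto simp: unfold_raw_def)

lemma fold_unfold:
  assumes y: "y \<in> standard_simplex n"
  shows "fold_map n c (unfold_map n c a y) = y"
proof -
  let ?s = "1 / (\<Sum>j\<le>n. unfold_raw n c a y j)"
  have s: "?s > 0" using sum_unfold_raw_pos[OF y, of a] by simp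
  have "fold_map n c (unfold_map n c a y) = normalize_sum n (\<lambda>j. ?s * fold_raw n c (unfold_raw n c a y) j)"
    unfolding fold_map_def unfold_map_def normalize_sum_eq_scale[of n "unfold_raw n c a y"]
    using s by (subst fold_raw_scale) auto
  also have "\<dots> = normalize_sum n (fold_raw n c (unfold_raw n c a y))"
    by (rule normalize_sum_scale) (use s in simp)
  also have "fold_raw n c (unfold_raw n c a y) = y"
    using n c simplexD[OF y] by (intro fold_unfold_raw) auto
  finally show ?thesis using normalize_sum_simplex[OF y] by simp
qed

lemma unfold_fold:
  assumes x: "x \<in> standard_simplex n" and a: "a \<Longrightarrow> x 0 \<le> x 1" "\<not> a \<Longrightarrow> x 1 \<le> x 0"
  shows "unfold_map n c a (fold_map n c x) = x"
proof -
  let ?s = "1 / (\<Sum>j\<le>n. fold_raw n c x j)"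
  have s: "?s > 0" using sum_fold_raw_pos[OF x] by simp
  have "unfold_map n c a (fold_map n c x) = normalize_sum n (\<lambda>j. ?s * unfold_raw n c a (fold_raw n c x) j)"
    unfolding fold_map_def unfold_map_def normalize_sum_eq_scale[of n "fold_raw n c x"]
    by (subst unfold_raw_scale) simp
  also have "\<dots> = normalize_sum n (unfold_raw n c a (fold_raw n c x))"
    by (rule normalize_sum_scale) (use s in simp)
  also have "unfold_raw n c a (fold_raw n c x) = x"
    using n c simplexD[OF x] a by (intro unfold_fold_raw) auto
  finally show ?thesis using normalize_sum_simplex[OF x] by simp
qed

lemma unfold_map_order:
  assumes y: "y \<in> standard_simplex n"
  shows "unfold_map n c True y 0 \<le> unfold_map n c True y 1"
    "unfold_map n c False y 1 \<le> unfold_map n c False y 0"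
    "unfold_map n c a y 0 = unfold_map n c a y 1 \<longleftrightarrow> y 0 = 0"
  using sum_unfold_raw_pos[OF y, of True] sum_unfold_raw_pos[OF y, of False] sum_unfold_raw_pos[OF y, of a]
    simplexD(1)[OF y, of 0]
  by (auto simp: unfold_map_def normalize_sum_def unfold_raw_def divide_right_mono)

text \<open>The letter only decides which of the first two coordinates receives \<open>y 0\<close>,
  so the two inverse branches glue along this facet.\<close>

lemma unfold_map_indep: "y 0 = 0 \<Longrightarrow> unfold_map n c a y = unfold_map n c b y"
proof -
  assume "y 0 = 0"
  then have "unfold_raw n c a y = unfold_raw n c b y" by (simp add: unfold_raw_def fun_eq_iff)
  then show ?thesis by (simp add: unfold_map_def)
qed

lemma fold_map_coord_0: "x \<in> standard_simplex n \<Longrightarrow> fold_map n c x 0 = 0 \<longleftrightarrow> x 0 = x 1"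
  using sum_fold_raw_pos[of x] by (auto simp: fold_map_def normalize_sum_def fold_raw_def)

lemma continuous_on_fold_map: "continuous_on (standard_simplex n) (fold_map n c)"
proof (rule continuous_on_coordinatewise_then_product)
  fix j
  have raw: "continuous_on (standard_simplex n) (\<lambda>x. fold_raw n c x i)" for i
    unfolding fold_raw_def
    using c by (cases "i = 0"; cases "i < n"; cases "i = n")
      (auto intro!: continuous_intros continuous_on_product_then_coordinatewise[OF continuous_on_id])
  show "continuous_on (standard_simplex n) (\<lambda>x. fold_map n c x j)"
    unfolding fold_map_def normalize_sum_def
    using sum_fold_raw_pos by (intro continuous_intros raw) force
qed

lemma continuous_on_unfold_map: "continuous_on (standard_simplex n) (unfold_map n c a)"
proof (rule continuous_on_coordinatewise_then_product)
  fix j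
  have raw: "continuous_on (standard_simplex n) (\<lambda>y. unfold_raw n c a y i)" for i
    unfolding unfold_raw_def
    by (cases "i = 0"; cases "i = 1"; cases "i \<le> n"; cases a)
      (auto intro!: continuous_intros continuous_on_product_then_coordinatewise[OF continuous_on_id])
  show "continuous_on (standard_simplex n) (\<lambda>x. unfold_map n c a x j)"
    unfolding unfold_map_def normalize_sum_def
    using sum_unfold_raw_pos[of _ a] by (intro continuous_intros raw) force
qed

section \<open>Cells of the coding and the orbits of their vertices\<close>

primrec cell :: "bool list \<Rightarrow> (nat \<Rightarrow> real) \<Rightarrow> nat \<Rightarrow> real" where
  "cell [] y = y"
| "cell (a # w) y = unfold_map n c a (cell w y)"

lemma cell_in: "y \<in> standard_simplex n \<Longrightarrow> cell w y \<in> standard_simplex n"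
  by (induction w) (auto intro: unfold_map_in)

text \<open>\<open>unfold_map\<close> is not linear, but its normalizing factors cancel in a
  quotient of two functionals, leaving the transposes of the linear maps \<open>unfold_raw\<close>.
  With \<open>l'\<close> constantly 1 the left side is the plain value of \<open>l\<close>.\<close>

lemma cell_ratio:
  assumes y: "y \<in> standard_simplex n"
  shows "(\<Sum>j\<le>n. cell w y j * l j) / (\<Sum>j\<le>n. cell w y j * l' j) =
    (\<Sum>j\<le>n. y j * fold (dual_step n c) w l j) / (\<Sum>j\<le>n. y j * fold (dual_step n c) w l' j)"
proof (induction w arbitrary: l l')
  case (Cons a w)
  let ?z = "cell w y"
  let ?s = "1 / (\<Sum>j\<le>n. unfold_raw n c a ?z j)"
  have s: "?s \<noteq> 0" using sum_unfold_raw_pos[OF cell_in[OF y], of a w] by simp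
  have "(\<Sum>j\<le>n. cell (a # w) y j * l j) = ?s * (\<Sum>j\<le>n. ?z j * dual_step n c a l j)" for l
    unfolding cell.simps unfold_map_def normalize_sum_eq_scale sum_unfold_raw[OF n, symmetric] sum_distrib_left
    by (simp add: mult.assoc)
  then have "(\<Sum>j\<le>n. cell (a # w) y j * l j) / (\<Sum>j\<le>n. cell (a # w) y j * l' j) =
     (\<Sum>j\<le>n. ?z j * dual_step n c a l j) / (\<Sum>j\<le>n. ?z j * dual_step n c a l' j)"
    by (simp only: mult_divide_mult_cancel_left[OF s])
  then show ?case using Cons by simp
qed simp

text \<open>For \<open>l\<close> the \<open>i\<close>-th coordinate and for \<open>l\<close>
  constantly 1, component \<open>j\<close> is the numerator and the denominator of coordinate
  \<open>i\<close> at the \<open>j\<close>-th vertex of the cell with word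
  \<open>\<alpha> 0, ..., \<alpha> (k - 1)\<close>.\<close>

definition dual_orbit :: "(nat \<Rightarrow> bool) \<Rightarrow> (nat \<Rightarrow> real) \<Rightarrow> nat \<Rightarrow> nat \<Rightarrow> real" where
  "dual_orbit \<alpha> l k = fold (dual_step n c) (map \<alpha> [0..<k]) l"

lemma dual_orbit_0: "dual_orbit \<alpha> l 0 = l"
  and dual_orbit_Suc: "dual_orbit \<alpha> l (Suc k) = dual_step n c (\<alpha> k) (dual_orbit \<alpha> l k)"
  by (simp_all add: dual_orbit_def)

text \<open>Components 1 to \<open>n\<close> move up one place per step. The whole vector is thus
  recovered from component 0 and the later values of component 1, as \<open>mediant_process\<close>
  requires.\<close>

lemma dual_orbit_queue: "m < n \<Longrightarrow> dual_orbit \<alpha> l (k + m) 1 = dual_orbit \<alpha> l k (Suc m)"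
proof (induction m arbitrary: k)
  case (Suc m)
  have "dual_orbit \<alpha> l (k + Suc m) 1 = dual_orbit \<alpha> l (Suc k) (Suc m)" using Suc.IH[of "Suc k"] Suc.prems by simp
  also have "\<dots> = dual_orbit \<alpha> l k (Suc (Suc m))"
    using Suc.prems by (simp add: dual_orbit_Suc dual_step_def)
  finally show ?case .
qed simp

lemma dual_orbit_step: "dual_orbit \<alpha> l (k + n) 1 = c * (dual_orbit \<alpha> l k 0 + dual_orbit \<alpha> l k 1)"
  using dual_orbit_queue[of "n - 1" \<alpha> l "Suc k"] n by (simp add: dual_orbit_Suc dual_step_def)

text \<open>The last conjunct says that the vertex about to join the queue has a denominator no
  smaller than the present last one. It keeps the order intact, and it survives because components 0
  and 1 never decrease.\<close>

lemma denominators: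
  fixes \<alpha> :: "nat \<Rightarrow> bool" and k :: nat
  defines "D \<equiv> dual_orbit \<alpha> (\<lambda>_. 1)"
  shows "0 < D k 0 \<and> (\<forall>j<n. D k j \<le> D k (Suc j)) \<and> D k n \<le> c * (D k 0 + D k 1)"
proof (induction k)
  case 0
  then show ?case using c by (simp add: D_def dual_orbit_0)
next
  case (Suc k)
  have D: "D (Suc k) = dual_step n c (\<alpha> k) (D k)" unfolding D_def by (rule dual_orbit_Suc)
  have mono: "D k i \<le> D k j" if "i \<le> j" "j \<le> n" for i j
    using that(1,2)
  proof (induction rule: dec_induct)
    case (step m)
    then show ?case using Suc.IH order_trans[of "D k i" "D k m" "D k (Suc m)"] by auto
  qed simp
  have D01: "D k 0 \<le> D k 1" "D k 1 \<le> c * (D k 0 + D k 1)" "0 < D k 0" "D k n \<le> c * (D k 0 + D k 1)"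
    using Suc.IH mono[of 0 1] mono[of 1 n] n by auto
  have D0: "D k 0 \<le> D (Suc k) 0" "D (Suc k) 0 \<le> D k 1" using D01 by (auto simp: D dual_step_def)
  have "D (Suc k) j \<le> D (Suc k) (Suc j)" if "j < n" for j
  proof (cases "Suc j < n")
    case True
    then have "D (Suc k) (Suc j) = D k (Suc (Suc j))" by (simp add: D dual_step_def)
    moreover have "D (Suc k) j \<le> D k (Suc j)" using D0 that by (cases "j = 0") (auto simp: D dual_step_def)
    ultimately show ?thesis using mono[of "Suc j" "Suc (Suc j)"] True by simp
  next
    case False
    then have "Suc j = n" using that by simp
    then have "D (Suc k) (Suc j) = c * (D k 0 + D k 1)" by (simp add: D dual_step_def)
    moreover have "D (Suc k) j \<le> D k n" using D0 that mono[of 1 n] \<open>Suc j = n\<close>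
      by (cases "j = 0") (auto simp: D dual_step_def)
    ultimately show ?thesis using D01 by simp
  qed
  moreover have "D (Suc k) n \<le> c * (D (Suc k) 0 + D (Suc k) 1)"
  proof -
    have "D k 1 \<le> D (Suc k) 1"
      using D01 mono[of 1 2] by (cases "n = 1") (auto simp: D dual_step_def numeral_2_eq_2)
    then have "c * (D k 0 + D k 1) \<le> c * (D (Suc k) 0 + D (Suc k) 1)"
      using D0 c by (intro mult_left_mono) auto
    moreover have "D (Suc k) n = c * (D k 0 + D k 1)" using n by (simp add: D dual_step_def)
    ultimately show ?thesis by simp
  qed
  ultimately show ?case using D0 D01 by auto
qed

lemma mediant_process_dual_orbit:
  "mediant_process n \<alpha> (\<lambda>k. dual_orbit \<alpha> (\<lambda>_. 1) k 0) (\<lambda>k. dual_orbit \<alpha> (\<lambda>_. 1) k 1)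
    (\<lambda>k. dual_orbit \<alpha> l k 0 / dual_orbit \<alpha> (\<lambda>_. 1) k 0)
    (\<lambda>k. dual_orbit \<alpha> l k 1 / dual_orbit \<alpha> (\<lambda>_. 1) k 1)"
proof
  let ?D = "dual_orbit \<alpha> (\<lambda>_. 1)" and ?L = "dual_orbit \<alpha> l"
  fix k
  show D0: "0 < ?D k 0" and D1: "?D k 0 \<le> ?D k 1" using denominators[of \<alpha> k] n by auto
  show "?D k 1 \<le> ?D (Suc k) 1"
  proof (cases "n = 1")
    case True
    have "?D (Suc k) n = c * (?D k 0 + ?D k 1)" using n by (simp add: dual_orbit_Suc dual_step_def)
    then show ?thesis using denominators[of \<alpha> k] True by metis
  next
    case False
    then show ?thesis using denominators[of \<alpha> k] n by (simp add: dual_orbit_Suc dual_step_def)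
  qed
  show "?D (Suc k) 0 = (if \<alpha> k then ?D k 1 else ?D k 0)"
    "?L (Suc k) 0 / ?D (Suc k) 0 = (if \<alpha> k then ?L k 1 / ?D k 1 else ?L k 0 / ?D k 0)"
    by (simp_all add: dual_orbit_Suc dual_step_def)
  show "?D (k + n) 1 \<le> ?D k 0 + ?D k 1"
    unfolding dual_orbit_step using c D0 D1 mult_right_mono[of c 1 "?D k 0 + ?D k 1"] by simp
  \<comment> \<open>The factor \<open>c\<close> cancels here; it influences the process only through
    the denominators.\<close>
  show "?L (k + n) 1 / ?D (k + n) 1 =
    (?D k 0 * (?L k 0 / ?D k 0) + ?D k 1 * (?L k 1 / ?D k 1)) / (?D k 0 + ?D k 1)"
    unfolding dual_orbit_step using c D0 D1 by simp
qed (rule n)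

lemma cells_shrink:
  assumes "0 < \<epsilon>"
  obtains K where "\<And>w y y' i. K \<le> length w \<Longrightarrow> y \<in> standard_simplex n \<Longrightarrow> y' \<in> standard_simplex n \<Longrightarrow>
    \<bar>cell w y i - cell w y' i\<bar> \<le> \<epsilon>"
proof -
  from mediant_process_spread[OF n zero_le_one assms]
  obtain K where K: "\<And>a e d g p k. mediant_process n a e d g p \<Longrightarrow> mediant_process.spread_le n g p 0 1 \<Longrightarrow>
    d 0 \<le> 2 * e 0 \<Longrightarrow> K \<le> k \<Longrightarrow> mediant_process.spread_le n g p k \<epsilon>" by metis
  show ?thesis
  proof (rule that[of K])
    fix w :: "bool list" and y y' :: "nat \<Rightarrow> real" and i
    assume w: "K \<le> length w" and y: "y \<in> standard_simplex n" "y' \<in> standard_simplex n"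
    \<comment> \<open>Beyond the end of \<open>w\<close> these letters are unspecified. By
      \<open>dual_orbit_queue\<close>, the later heads of the queue that enter the spread at time
      \<open>length w\<close> are already determined by \<open>w\<close>.\<close>
    define \<alpha> where "\<alpha> k = w ! k" for k :: nat
    have map: "map \<alpha> [0..<length w] = w" unfolding \<alpha>_def by (rule map_nth)
    define l :: "nat \<Rightarrow> real" where "l j = (if j = i then 1 else 0)" for j
    let ?D = "dual_orbit \<alpha> (\<lambda>_. 1)" and ?L = "dual_orbit \<alpha> l" and ?k = "length w"
    interpret mediant_process n \<alpha> "\<lambda>k. ?D k 0" "\<lambda>k. ?D k 1" "\<lambda>k. ?L k 0 / ?D k 0" "\<lambda>k. ?L k 1 / ?D k 1"
      by (rule mediant_process_dual_orbit)
    have L: "?L k (Suc j) / ?D k (Suc j) = ?L (k + j) 1 / ?D (k + j) 1" if "j < n" for k j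
      using dual_orbit_queue[OF that] by simp
    have st: "?L k j / ?D k j \<in> insert (?L k 0 / ?D k 0) ((\<lambda>k. ?L k 1 / ?D k 1) ` {k..<k + n})" if "j \<le> n" for k j
      using L[of "j - 1" k] that by (cases j) auto
    have "spread_le 0 1"
    proof -
      have "x \<in> {0, 1}" if x: "x \<in> insert (?L 0 0 / ?D 0 0) ((\<lambda>k. ?L k 1 / ?D k 1) ` {0..<0 + n})" for x
      proof -
        have "x \<in> range (\<lambda>j. ?L 0 j / ?D 0 j)"
          using x
        proof (elim insertE imageE)
          fix k assume k: "x = ?L k 1 / ?D k 1" "k \<in> {0..<0 + n}"
          then have "x = ?L 0 (Suc k) / ?D 0 (Suc k)" using L[of k 0] by simp
          then show ?thesis by blast
        qed blast
        then show ?thesis by (auto simp: dual_orbit_0 l_def)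
      qed
      note * = this
      have "\<bar>x - y\<bar> \<le> 1" if "x \<in> {0, 1}" "y \<in> {0, 1}" for x y :: real using that by auto
      with * show ?thesis unfolding spread_le_def by blast
    qed
    then have sp: "spread_le ?k \<epsilon>" by (rule K[OF mediant_process_dual_orbit _ _ w]) (simp add: dual_orbit_0)
    have pos: "0 < ?D ?k j" if "j \<le> n" for j
      using that e_pos[of ?k] d_pos[of "?k + (j - 1)"] dual_orbit_queue[of "j - 1" \<alpha> "\<lambda>_. 1" ?k] by (cases j) (auto simp: Suc_le_eq)
    have r: "\<bar>?L ?k i / ?D ?k i - ?L ?k j / ?D ?k j\<bar> \<le> \<epsilon>" if "i \<le> n" "j \<le> n" for i j
      using sp st[OF that(1)] st[OF that(2)] unfolding spread_le_def by blast
    have ratio: "cell w z i = (\<Sum>j\<le>n. z j * ?L ?k j) / (\<Sum>j\<le>n. z j * ?D ?k j)" if z: "z \<in> standard_simplex n" "i \<le> n" for z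
    proof -
      have "(\<Sum>j\<le>n. cell w z j * l j) = cell w z i" using z by (simp add: l_def if_distrib cong: if_cong)
      moreover have "(\<Sum>j\<le>n. cell w z j * 1) = 1" using simplexD(4)[OF cell_in[OF z(1)]] by simp
      ultimately show ?thesis
        using cell_ratio[OF z(1), of w l "\<lambda>_. 1"] unfolding dual_orbit_def map by simp
    qed
    show "\<bar>cell w y i - cell w y' i\<bar> \<le> \<epsilon>"
    proof (cases "i \<le> n")
      case True
      show ?thesis unfolding ratio[OF y(1) True] ratio[OF y(2) True]
        by (rule weighted_average_close[OF y pos r])
    next
      case False
      then show ?thesis using simplexD(3)[OF cell_in] y assms by simp
    qed
  qed
qed

end

section \<open>Semiconjugacies between folding maps\<close>

lemma simplex_limit:
  assumes "\<And>k. X k \<in> standard_simplex n" "\<And>i. (\<lambda>k. X k i) \<longlonglongrightarrow> x i"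
  shows "x \<in> standard_simplex n"
proof (rule in_standard_simplexI)
  show "0 \<le> x j" for j
    by (rule LIMSEQ_le_const[OF assms(2)]) (use simplexD(1)[OF assms(1)] in auto)
  show "x j = 0" if "j > n" for j
    using LIMSEQ_unique[OF assms(2)[of j]] simplexD(3)[OF assms(1) that] by simp
  have "(\<lambda>k. \<Sum>j\<le>n. X k j) \<longlonglongrightarrow> (\<Sum>j\<le>n. x j)" by (intro tendsto_sum assms(2))
  then show "(\<Sum>j\<le>n. x j) = 1" using simplexD(4)[OF assms(1)] by (simp add: LIMSEQ_const_iff)
qed

locale two_foldings = src: folding n c1 + tgt: folding n c2 for n c1 c2
begin

abbreviation "S \<equiv> standard_simplex n"

text \<open>A solution of \<open>f x = lift f x\<close> is a semiconjugacy that also respects the two halves; iterating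
  \<open>lift\<close> from the identity produces one. Preservation of facets makes the two branches of \<open>lift f\<close> agree
  where \<open>x 0 = x 1\<close>.\<close>

definition lift :: "((nat \<Rightarrow> real) \<Rightarrow> nat \<Rightarrow> real) \<Rightarrow> (nat \<Rightarrow> real) \<Rightarrow> nat \<Rightarrow> real" where
  "lift f x = unfold_map n c2 (x 0 < x 1) (f (fold_map n c1 x))"

definition semiconjugacy :: "((nat \<Rightarrow> real) \<Rightarrow> nat \<Rightarrow> real) \<Rightarrow> bool" where
  "semiconjugacy f \<longleftrightarrow> (\<forall>x\<in>S. f x \<in> S \<and> f x = lift f x)"

definition facet_preserving :: "((nat \<Rightarrow> real) \<Rightarrow> nat \<Rightarrow> real) \<Rightarrow> bool" where
  "facet_preserving f \<longleftrightarrow> (\<forall>x\<in>S. f x \<in> S \<and> (\<forall>j\<le>n. x j = 0 \<longrightarrow> f x j = 0))"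

primrec itinerary :: "nat \<Rightarrow> (nat \<Rightarrow> real) \<Rightarrow> bool list" where
  "itinerary 0 x = []"
| "itinerary (Suc k) x = (x 0 < x 1) # itinerary k (fold_map n c1 x)"

lemma length_itinerary: "length (itinerary k x) = k"
  by (induction k arbitrary: x) auto

lemma fold_map_funpow_in: "x \<in> S \<Longrightarrow> (fold_map n c1 ^^ k) x \<in> S"
  by (induction k) (auto intro: src.fold_map_in)

text \<open>The first \<open>k\<close> letters of the code of \<open>x\<close> fix a cell, and
  \<open>f\<close> only selects a point of it. As cells shrink, the influence of \<open>f\<close>
  disappears; this yields both uniqueness and convergence.\<close>

lemma lift_funpow: "(lift ^^ k) f x = tgt.cell (itinerary k x) (f ((fold_map n c1 ^^ k) x))"
proof (induction k arbitrary: x)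
  case (Suc k)
  have "(lift ^^ Suc k) f x = unfold_map n c2 (x 0 < x 1) ((lift ^^ k) f (fold_map n c1 x))"
    by (simp add: lift_def)
  then show ?case unfolding Suc by (simp add: funpow_swap1)
qed simp

text \<open>On the simplex a solution is unchanged by every power of \<open>lift\<close>, so the
  values of two solutions at \<open>x\<close> lie in a common cell of any depth.\<close>

lemma semiconjugacy_unique:
  assumes f: "semiconjugacy f" and h: "semiconjugacy h" and x: "x \<in> S"
  shows "f x = h x"
proof
  fix i
  have funpow: "x \<in> S \<Longrightarrow> (lift ^^ k) f x = f x" if f: "semiconjugacy f" for f k x
  proof (induction k arbitrary: x)
    case (Suc k)
    have "(lift ^^ Suc k) f x = lift f x"
      using Suc.IH[OF src.fold_map_in[OF Suc.prems]] by (simp add: lift_def[of _ x])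
    then show ?case using f Suc.prems by (simp add: semiconjugacy_def)
  qed simp
  have "\<bar>f x i - h x i\<bar> \<le> \<epsilon>" if e: "0 < \<epsilon>" for \<epsilon>
  proof -
    from tgt.cells_shrink[OF e] obtain K where K: "\<And>w y y' i. K \<le> length w \<Longrightarrow> y \<in> S \<Longrightarrow> y' \<in> S \<Longrightarrow>
      \<bar>tgt.cell w y i - tgt.cell w y' i\<bar> \<le> \<epsilon>" by metis
    have S: "f ((fold_map n c1 ^^ K) x) \<in> S" "h ((fold_map n c1 ^^ K) x) \<in> S"
      using f h fold_map_funpow_in[OF x, of K] unfolding semiconjugacy_def by blast+
    show ?thesis
      using K[OF _ S, of "itinerary K x" i] funpow[OF f x, of K] funpow[OF h x, of K]
      by (simp add: lift_funpow length_itinerary)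
  qed
  then show "f x i = h x i" using dense_ge[of "0::real" "\<bar>f x i - h x i\<bar>"] by force
qed

text \<open>If \<open>x j = 0\<close>, every coordinate of the folded point that enters coordinate
  \<open>j\<close> of the branch chosen by \<open>x\<close> vanishes as well, and \<open>f\<close>
  keeps these zeros.\<close>

lemma facet_preserving_lift:
  assumes "facet_preserving f"
  shows "facet_preserving (lift f)"
  unfolding facet_preserving_def
proof (intro ballI conjI allI impI)
  fix x assume x: "x \<in> S"
  let ?u = "fold_map n c1 x"
  let ?y = "f ?u"
  have u: "?u \<in> S" by (rule src.fold_map_in[OF x])
  have y: "?y \<in> S" using assms u by (simp add: facet_preserving_def)
  show "lift f x \<in> S" unfolding lift_def by (rule tgt.unfold_map_in[OF y])
  fix j assume j: "j \<le> n" "x j = 0"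
  have f0: "?y i = 0" if "i \<le> n" "fold_raw n c1 x i = 0" for i
    using assms u that by (simp add: facet_preserving_def fold_map_def normalize_sum_def)
  have x0: "0 \<le> x 0" "0 \<le> x 1" using simplexD(1)[OF x] by auto
  have n: "n \<ge> 1" by (rule src.n)
  have "unfold_raw n c2 (x 0 < x 1) ?y j = 0"
  proof -
    consider "j = 0" | "j = 1" | "j \<ge> 2" by linarith
    then show ?thesis
    proof cases
      case 1
      then have "fold_raw n c1 x n = 0" using x0 j n by (simp add: fold_raw_def min_def)
      then have "?y n = 0" by (intro f0) auto
      moreover have "?y 0 = 0" if "\<not> x 0 < x 1"
        using that x0 j 1 by (intro f0) (auto simp: fold_raw_def)
      ultimately show ?thesis using 1 by (simp add: unfold_raw_def)
    next
      case 2
      then have "fold_raw n c1 x n = 0" using x0 j n by (simp add: fold_raw_def min_def)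
      then have "?y n = 0" by (intro f0) auto
      then show ?thesis using 2 x0 j by (simp add: unfold_raw_def)
    next
      case 3
      then have "?y (j - 1) = 0" using j by (intro f0) (auto simp: fold_raw_def)
      then show ?thesis using 3 by (simp add: unfold_raw_def)
    qed
  qed
  then show "lift f x j = 0" by (simp add: lift_def unfold_map_def normalize_sum_def)
qed

lemma continuous_on_lift:
  assumes "facet_preserving f" "continuous_on S f"
  shows "continuous_on S (lift f)"
proof -
  have fS: "f ` S \<subseteq> S" using assms(1) by (auto simp: facet_preserving_def)
  have c: "continuous_on S (\<lambda>x. unfold_map n c2 a (f (fold_map n c1 x)))" for a
    using continuous_on_compose2[OF tgt.continuous_on_unfold_map
        continuous_on_compose2[OF assms(2) src.continuous_on_fold_map]] src.fold_map_in fS by blast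
  have co: "continuous_on S (\<lambda>x. x 1 - x 0 :: real)"
    by (intro continuous_intros continuous_on_product_then_coordinatewise[OF continuous_on_id])
  have "continuous_on S (\<lambda>x. if x 1 - x 0 \<le> 0 then unfold_map n c2 False (f (fold_map n c1 x))
      else unfold_map n c2 True (f (fold_map n c1 x)))"
  proof (rule continuous_on_cases_le[OF continuous_on_subset[OF c] continuous_on_subset[OF c] co])
    fix x assume x: "x \<in> S" "x 1 - x 0 = 0"
    then have "fold_map n c1 x 0 = 0" using src.fold_map_coord_0 by simp
    then have "f (fold_map n c1 x) 0 = 0" using assms(1) src.fold_map_in[OF x(1)] by (simp add: facet_preserving_def)
    then show "unfold_map n c2 False (f (fold_map n c1 x)) = unfold_map n c2 True (f (fold_map n c1 x))"
      by (rule tgt.unfold_map_indep)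
  qed auto
  then show ?thesis
  proof (rule continuous_on_cong[THEN iffD1, rotated -1])
    show "(if x 1 - x 0 \<le> 0 then unfold_map n c2 False (f (fold_map n c1 x))
      else unfold_map n c2 True (f (fold_map n c1 x))) = lift f x" for x
      by (auto simp: lift_def)
  qed simp
qed

lemma ex_semiconjugacy:
  obtains f where "semiconjugacy f" "facet_preserving f" "continuous_on S f"
proof -
  define F where "F k = (lift ^^ k) id" for k
  have F: "facet_preserving (F k) \<and> continuous_on S (F k)" for k
    unfolding F_def
  proof (induction k)
    case 0
    then show ?case by (auto simp: facet_preserving_def id_def)
  next
    case (Suc k)
    then show ?case using facet_preserving_lift continuous_on_lift by simp
  qed
  then have FS: "F k x \<in> S" if "x \<in> S" for k x using that by (simp add: facet_preserving_def)
  have cauchy: "uniformly_Cauchy_on S (\<lambda>k x. F k x i)" for i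
  proof (rule uniformly_Cauchy_onI')
    fix e :: real assume "0 < e"
    then have "0 < e / 2" by simp
    from tgt.cells_shrink[OF this] obtain K where K: "\<And>w y y' i. K \<le> length w \<Longrightarrow> y \<in> S \<Longrightarrow> y' \<in> S \<Longrightarrow>
      \<bar>tgt.cell w y i - tgt.cell w y' i\<bar> \<le> e / 2" by metis
    have "dist (F k x i) (F l x i) < e" if x: "x \<in> S" and "K \<le> k" "k < l" for x k l
    proof -
      have u: "(fold_map n c1 ^^ k) x \<in> S" by (rule fold_map_funpow_in[OF x])
      \<comment> \<open>Both iterates end with the same \<open>k\<close> branches, applied to two
        points of the simplex, so their values at \<open>x\<close> share a cell of depth
        \<open>k\<close>.\<close>
      have "F l = (lift ^^ k) (F (l - k))" unfolding F_def using that funpow_add[of k "l - k" lift] by simp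
      then have "\<bar>F k x i - F l x i\<bar> \<le> e / 2"
        using K[of "itinerary k x" "id ((fold_map n c1 ^^ k) x)" "F (l - k) ((fold_map n c1 ^^ k) x)" i]
          that u FS[OF u] by (simp add: F_def lift_funpow length_itinerary)
      then show ?thesis using \<open>0 < e\<close> by (simp add: dist_real_def)
    qed
    then show "\<exists>M. \<forall>x\<in>S. \<forall>m\<ge>M. \<forall>n>m. dist (F m x i) (F n x i) < e" by blast
  qed
  have "\<exists>l. uniform_limit S (\<lambda>k x. F k x i) l sequentially" for i
    using Cauchy_uniformly_convergent[OF cauchy] by (simp add: uniformly_convergent_on_def)
  then obtain L where L: "\<And>i. uniform_limit S (\<lambda>k x. F k x i) (L i) sequentially" by metis
  define f where "f x i = L i x" for x i
  have lim: "(\<lambda>k. F k x i) \<longlonglongrightarrow> f x i" if "x \<in> S" for x i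
    unfolding f_def by (rule tendsto_uniform_limitI[OF L that])
  have fS: "f x \<in> S" if "x \<in> S" for x
    by (rule simplex_limit[of "\<lambda>k. F k x"]) (use FS lim that in auto)
  have "continuous_on S f"
  proof (rule continuous_on_coordinatewise_then_product)
    fix i
    have "continuous_on S (L i)"
      by (rule uniform_limit_theorem[OF _ L])
        (use F in \<open>simp_all add: always_eventually continuous_on_product_then_coordinatewise\<close>)
    then show "continuous_on S (\<lambda>x. f x i)" by (simp add: f_def)
  qed
  moreover have "facet_preserving f"
    unfolding facet_preserving_def
  proof (intro ballI conjI allI impI)
    fix x j assume x: "x \<in> S" and "j \<le> n" "x j = 0"
    then have "F k x j = 0" for k using F by (simp add: facet_preserving_def)
    then show "f x j = 0" using LIMSEQ_unique[OF lim[OF x, of j]] by simp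
  qed (rule fS)
  moreover have "semiconjugacy f"
    unfolding semiconjugacy_def
  proof (intro ballI conjI)
    fix x assume x: "x \<in> S"
    show "f x \<in> S" by (rule fS[OF x])
    let ?u = "fold_map n c1 x" and ?a = "x 0 < x 1"
    have u: "?u \<in> S" by (rule src.fold_map_in[OF x])
    show "f x = lift f x"
    proof
      fix i
      \<comment> \<open>The letter of \<open>x\<close> does not change with \<open>k\<close>, so the
        limit passes through a single continuous branch.\<close>
      have raw: "(\<lambda>k. unfold_raw n c2 ?a (F k ?u) j) \<longlonglongrightarrow> unfold_raw n c2 ?a (f ?u) j" for j
        unfolding unfold_raw_def using lim[OF u]
        by (cases "j = 0"; cases "j = 1"; cases "j \<le> n"; cases ?a) (auto intro!: tendsto_intros)
      have "(\<lambda>k. unfold_map n c2 ?a (F k ?u) i) \<longlonglongrightarrow> unfold_map n c2 ?a (f ?u) i"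
        unfolding unfold_map_def normalize_sum_def
        using tgt.sum_unfold_raw_pos[OF fS[OF u], of ?a] by (intro tendsto_intros raw) auto
      moreover have "unfold_map n c2 ?a (F k ?u) i = F (Suc k) x i" for k by (simp add: F_def lift_def)
      ultimately show "f x i = lift f x i"
        using LIMSEQ_unique[OF LIMSEQ_Suc[OF lim[OF x, of i]]] by (simp add: lift_def)
    qed
  qed
  ultimately show ?thesis using that by blast
qed

lemma semiconjugacy_commute:
  assumes "semiconjugacy f" "x \<in> S"
  shows "fold_map n c2 (f x) = f (fold_map n c1 x)"
  using assms tgt.fold_unfold[of "f (fold_map n c1 x)" "x 0 < x 1"] src.fold_map_in[OF assms(2)]
  unfolding semiconjugacy_def lift_def by metis

end

lemma (in folding) semiconjugacy_id: "two_foldings.semiconjugacy n c c (\<lambda>x. x)"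
proof -
  interpret two_foldings n c c by unfold_locales
  show ?thesis unfolding semiconjugacy_def lift_def using unfold_fold by auto
qed

text \<open>The composition of \<open>f\<close> and \<open>h\<close> solves the lifting equation
  from the \<open>c\<close>-folding to itself, which the identity solves too.\<close>

lemma semiconjugacy_inverse:
  assumes "two_foldings n c d"
    and f: "two_foldings.semiconjugacy n c d f" "two_foldings.facet_preserving n f"
    and h: "two_foldings.semiconjugacy n d c h" "two_foldings.facet_preserving n h"
    and x: "x \<in> standard_simplex n"
  shows "h (f x) = x"
proof -
  interpret cd: two_foldings n c d by (rule assms(1))
  interpret dc: two_foldings n d c by unfold_locales
  interpret cc: two_foldings n c c by unfold_locales
  have fS: "f x \<in> cc.S" and fx: "f x = cd.lift f x" if "x \<in> cc.S" for x
    using f(1) that by (auto simp: cd.semiconjugacy_def)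
  have hS: "h x \<in> cc.S" and hx: "h x = dc.lift h x" if "x \<in> cc.S" for x
    using h(1) that by (auto simp: dc.semiconjugacy_def)
  have "cc.semiconjugacy (\<lambda>x. h (f x))"
    unfolding cc.semiconjugacy_def
  proof (intro ballI conjI)
    fix x assume x: "x \<in> cc.S"
    show "h (f x) \<in> cc.S" by (rule hS[OF fS[OF x]])
    let ?y = "f (fold_map n c x)"
    have y: "?y \<in> cc.S" by (rule fS[OF cd.src.fold_map_in[OF x]])
    \<comment> \<open>\<open>f x\<close> lies in the closed half belonging to the letter of
      \<open>x\<close>, so the letters can differ only if \<open>f x\<close> is on the wall. Then
      \<open>?y\<close> and \<open>h ?y\<close> lie in the facet where both branches agree.\<close>
    have "unfold_map n c (f x 0 < f x 1) (h ?y) = unfold_map n c (x 0 < x 1) (h ?y)"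
    proof (cases "(f x 0 < f x 1) = (x 0 < x 1)")
      case False
      have fx': "f x = unfold_map n d (x 0 < x 1) ?y" using fx[OF x] by (simp add: cd.lift_def)
      have "f x 0 = f x 1"
        using False fx' cd.tgt.unfold_map_order(1,2)[OF y] by (cases "x 0 < x 1") auto
      then have "?y 0 = 0" using cd.tgt.unfold_map_order(3)[OF y] fx' by metis
      then have "h ?y 0 = 0" using h(2) y by (simp add: dc.facet_preserving_def)
      then show ?thesis by (rule cd.src.unfold_map_indep)
    qed simp
    then show "h (f x) = cc.lift (\<lambda>x. h (f x)) x"
      using hx[OF fS[OF x]] cd.semiconjugacy_commute[OF f(1) x] by (simp add: dc.lift_def cc.lift_def)
  qed
  then show ?thesis by (rule cc.semiconjugacy_unique[OF _ cd.src.semiconjugacy_id x])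
qed

section \<open>Homeomorphisms commuting with a folding map\<close>

definition segment :: "(nat \<Rightarrow> real) \<Rightarrow> (nat \<Rightarrow> real) \<Rightarrow> real \<Rightarrow> nat \<Rightarrow> real" where
  "segment x y t = (\<lambda>j. (1 - t) * x j + t * y j)"

lemma segment_in:
  assumes "x \<in> standard_simplex n" "y \<in> standard_simplex n" "t \<in> {0..1}"
  shows "segment x y t \<in> standard_simplex n"
proof (rule in_standard_simplexI)
  show "(\<Sum>j\<le>n. segment x y t j) = 1"
    using simplexD(4)[OF assms(1)] simplexD(4)[OF assms(2)]
    by (simp add: segment_def sum.distrib sum_distrib_left[symmetric])
qed (use assms simplexD(1,3)[OF assms(1)] simplexD(1,3)[OF assms(2)] in \<open>auto simp: segment_def\<close>)

lemma continuous_on_segment: "continuous_on A (segment x y)"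
  unfolding segment_def by (rule continuous_on_coordinatewise_then_product) (intro continuous_intros)

text \<open>The inverse is a parameter so that the hypotheses are symmetric and each result
  transfers to \<open>h'\<close> through \<open>inverse\<close>.\<close>

locale folding_automorphism = folding +
  fixes h h' :: "(nat \<Rightarrow> real) \<Rightarrow> nat \<Rightarrow> real"
  assumes h_in: "x \<in> standard_simplex n \<Longrightarrow> h x \<in> standard_simplex n"
    and h'_in: "x \<in> standard_simplex n \<Longrightarrow> h' x \<in> standard_simplex n"
    and h'_h: "x \<in> standard_simplex n \<Longrightarrow> h' (h x) = x"
    and h_h': "x \<in> standard_simplex n \<Longrightarrow> h (h' x) = x"
    and cont_h: "continuous_on (standard_simplex n) h"
    and cont_h': "continuous_on (standard_simplex n) h'"
    and commute: "x \<in> standard_simplex n \<Longrightarrow> fold_map n c (h x) = h (fold_map n c x)"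
begin

lemma inverse: "folding_automorphism n c h' h"
proof
  fix x assume x: "x \<in> standard_simplex n"
  have "h' (fold_map n c (h (h' x))) = fold_map n c (h' x)"
    using commute[OF h'_in[OF x]] h'_h[OF fold_map_in[OF h'_in[OF x]]] by simp
  then show "fold_map n c (h' x) = h' (fold_map n c x)" using h_h'[OF x] by simp
qed (auto simp: h_in h'_in h_h' h'_h cont_h cont_h')

lemma continuous_along_segment:
  assumes "x \<in> standard_simplex n" "y \<in> standard_simplex n"
  shows "continuous_on {0..1} (\<lambda>t. h (segment x y t) 0 - h (segment x y t) 1)"
proof -
  have cont: "continuous_on {0..1} (\<lambda>t. h (segment x y t))"
    by (rule continuous_on_compose2[OF cont_h continuous_on_segment]) (use segment_in[OF assms] in auto)
  show ?thesis by (intro continuous_on_diff continuous_on_product_then_coordinatewise[OF cont])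
qed

text \<open>The wall \<open>x 0 = x 1\<close> is where the folding map fails to be locally injective.\<close>

lemma wall:
  assumes x: "x \<in> standard_simplex n" and eq: "x 0 = x 1"
  shows "h x 0 = h x 1"
proof (rule ccontr)
  assume ne: "h x 0 \<noteq> h x 1"
  \<comment> \<open>Moving \<open>x\<close> from the wall by equal amounts towards \<open>e0\<close>
    and \<open>e1\<close> gives two mirror images with the same fold. For small amounts
    \<open>h\<close> keeps both on the side of \<open>h x\<close>, where folding is
    injective.\<close>
  define e0 e1 :: "nat \<Rightarrow> real" where "e0 = (\<lambda>i. if i = 0 then 1 else 0)" and "e1 = (\<lambda>i. if i = 1 then 1 else 0)"
  have e: "e0 \<in> standard_simplex n" "e1 \<in> standard_simplex n"
    unfolding e0_def e1_def using n by (auto intro!: in_standard_simplexI)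
  define \<tau> where "\<tau> k = inverse (real (Suc k))" for k
  have \<tau>: "\<tau> k \<in> {0..1}" "\<tau> k > 0" for k by (auto simp: \<tau>_def field_simps)
  have \<tau>0: "\<tau> \<longlonglongrightarrow> 0" unfolding \<tau>_def by (rule LIMSEQ_inverse_real_of_nat)
  define D where "D = h x 0 - h x 1"
  have seg0: "segment x y 0 = x" for y by (simp add: segment_def)
  have pos: "\<forall>\<^sub>F k in sequentially. 0 < D * (h (segment x y (\<tau> k)) 0 - h (segment x y (\<tau> k)) 1)"
    if y: "y \<in> standard_simplex n" for y
  proof (rule order_tendstoD)
    show "(\<lambda>k. D * (h (segment x y (\<tau> k)) 0 - h (segment x y (\<tau> k)) 1)) \<longlonglongrightarrow> D * D"
      using continuous_on_tendsto_compose[OF continuous_along_segment[OF x y] \<tau>0] \<tau>(1)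
      by (intro tendsto_mult tendsto_const) (simp add: seg0 D_def)
    show "0 < D * D" using ne unfolding D_def by (simp add: zero_less_mult_iff) linarith
  qed
  from eventually_happens'[OF sequentially_bot eventually_conj[OF pos[OF e(1)] pos[OF e(2)]]]
  obtain k where k: "0 < D * (h (segment x e0 (\<tau> k)) 0 - h (segment x e0 (\<tau> k)) 1)"
    "0 < D * (h (segment x e1 (\<tau> k)) 0 - h (segment x e1 (\<tau> k)) 1)" by blast
  let ?u = "segment x e0 (\<tau> k)" and ?v = "segment x e1 (\<tau> k)"
  have uv: "?u \<in> standard_simplex n" "?v \<in> standard_simplex n" using segment_in[OF x] e \<tau> by auto
  have "\<bar>?u 0 - ?u 1\<bar> = \<bar>?v 0 - ?v 1\<bar>" "min (?u 0) (?u 1) = min (?v 0) (?v 1)"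
    using eq by (simp_all add: segment_def e0_def e1_def)
  moreover have "?u (Suc j) = ?v (Suc j)" if "j \<noteq> 0" for j
    using that by (simp add: segment_def e0_def e1_def)
  ultimately have "fold_raw n c ?u = fold_raw n c ?v"
    unfolding fold_raw_def fun_eq_iff by simp
  then have "h (fold_map n c ?u) = h (fold_map n c ?v)" by (simp add: fold_map_def)
  then have f: "fold_map n c (h ?u) = fold_map n c (h ?v)" using commute uv by simp
  have sgn: "D < 0 \<Longrightarrow> h ?u 0 \<le> h ?u 1 \<and> h ?v 0 \<le> h ?v 1" "\<not> D < 0 \<Longrightarrow> h ?u 1 \<le> h ?u 0 \<and> h ?v 1 \<le> h ?v 0"
    using k by (auto simp: zero_less_mult_iff)
  have "h ?u = unfold_map n c (D < 0) (fold_map n c (h ?u))"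
    by (rule unfold_fold[symmetric]) (use h_in uv sgn in auto)
  also have "\<dots> = h ?v"
    unfolding f by (rule unfold_fold) (use h_in uv sgn in auto)
  finally have "?u = ?v" using h'_h uv by metis
  then have "?u 0 = ?v 0" by simp
  then show False using \<tau>(2)[of k] by (simp add: segment_def e0_def e1_def)
qed

lemma wall_iff: "x \<in> standard_simplex n \<Longrightarrow> h x 0 = h x 1 \<longleftrightarrow> x 0 = x 1"
  using wall folding_automorphism.wall[OF inverse h_in] h'_h by metis

text \<open>The vertex \<open>e1\<close> lies in the image of the wall, the facet \<open>x 0 = 0\<close>, which is contained in
  \<open>x 0 \<le> x 1\<close>. This rules out that \<open>h\<close> swaps the two halves.\<close>

lemma side:
  assumes x: "x \<in> standard_simplex n" and lt: "x 0 < x 1"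
  shows "h x 0 < h x 1"
proof -
  define e1 :: "nat \<Rightarrow> real" where "e1 = (\<lambda>i. if i = 1 then 1 else 0)"
  have e: "e1 \<in> standard_simplex n" unfolding e1_def using n by (auto intro!: in_standard_simplexI)
  define w where "w = unfold_map n c False e1"
  have w: "w \<in> standard_simplex n" "fold_map n c w = e1"
    unfolding w_def using unfold_map_in[OF e] fold_unfold[OF e] by auto
  have "w 0 = w 1" unfolding w_def using unfold_map_order(3)[OF e] by (simp add: e1_def)
  then have "fold_map n c (h w) 0 = 0" using wall[OF w(1)] fold_map_coord_0[OF h_in[OF w(1)]] by simp
  then have "h e1 0 = 0" using commute[OF w(1)] w(2) by simp
  moreover have "h e1 0 \<noteq> h e1 1" using wall_iff[OF e] by (simp add: e1_def)
  ultimately have start: "h e1 0 - h e1 1 < 0" using simplexD(1)[OF h_in[OF e], of 1] by linarith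
  show ?thesis
  proof (rule ccontr)
    assume "\<not> ?thesis"
    \<comment> \<open>Otherwise \<open>h\<close> sends some point of the segment from
      \<open>e1\<close> to \<open>x\<close> to the wall, and \<open>wall_iff\<close> puts that point
      itself on the wall; but coordinate 1 exceeds coordinate 0 along the whole segment.\<close>
    then have "\<exists>t\<ge>0. t \<le> 1 \<and> h (segment e1 x t) 0 - h (segment e1 x t) 1 = 0"
      using start by (intro IVT' continuous_along_segment e x) (auto simp: segment_def)
    then obtain t where t: "0 \<le> t" "t \<le> 1" "h (segment e1 x t) 0 = h (segment e1 x t) 1" by auto
    then have "segment e1 x t 0 = segment e1 x t 1"
      using wall_iff segment_in[OF e x] by simp
    then have "1 - t + t * (x 1 - x 0) = 0" by (simp add: segment_def e1_def algebra_simps)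
    moreover have "0 \<le> t * (x 1 - x 0)" using t lt by simp
    ultimately have "t = 1" "t * (x 1 - x 0) = 0" using t by linarith+
    then show False using lt by simp
  qed
qed

lemma automorphism_trivial:
  assumes x: "x \<in> standard_simplex n"
  shows "h x = x"
proof -
  interpret two_foldings n c c by unfold_locales
  have "semiconjugacy h"
    unfolding semiconjugacy_def
  proof (intro ballI conjI)
    fix x assume x: "x \<in> standard_simplex n"
    show "h x \<in> standard_simplex n" by (rule h_in[OF x])
    have "(h x 0 < h x 1) = (x 0 < x 1)"
      using side[OF x] folding_automorphism.side[OF inverse h_in[OF x]] h'_h[OF x] by auto
    then have "unfold_map n c (x 0 < x 1) (fold_map n c (h x)) = h x"
      by (intro unfold_fold h_in x) auto
    then show "h x = lift h x" unfolding lift_def commute[OF x] by simp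
  qed
  then show ?thesis by (rule semiconjugacy_unique[OF _ semiconjugacy_id x])
qed

end

section \<open>Transfer to the simplex in affine coordinates\<close>

text \<open>Barycentric coordinates with respect to the columns of \<open>V_mat\<close>: column 0 is
  the origin, and column \<open>j\<close> for \<open>j \<ge> 1\<close> is the point with
  \<open>n + 1 - j\<close> leading ones. At \<open>j = 1\<close> the subtracted term is
  \<open>x n\<close>, which is 0 on the simplex.\<close>

definition bary :: "nat \<Rightarrow> (nat \<Rightarrow> real) \<Rightarrow> nat \<Rightarrow> real" where
  "bary n x = (\<lambda>j. if j = 0 then 1 - x 0 else if j \<le> n then x (n - j) - x (n + 1 - j) else 0)"

definition unbary :: "nat \<Rightarrow> (nat \<Rightarrow> real) \<Rightarrow> nat \<Rightarrow> real" where
  "unbary n \<beta> = (\<lambda>i. if i < n then \<Sum>j=1..n - i. \<beta> j else 0)"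

lemma unbary_diff: "m \<le> n \<Longrightarrow> unbary n \<beta> (n - m) = (\<Sum>j=1..m. \<beta> j)"
  by (cases "m = 0") (auto simp: unbary_def)

lemma sum_bary: "m \<le> n \<Longrightarrow> (\<Sum>j=1..m. bary n x j) = x (n - m) - x n"
proof (induction m)
  case (Suc m)
  then show ?case by (simp add: bary_def)
qed simp

lemma sum_atMost_split: "(\<Sum>j\<le>n. f j) = f 0 + (\<Sum>j=1..n. f j)" for f :: "nat \<Rightarrow> real"
  by (simp add: atMost_atLeast0 sum.atLeast_Suc_atMost)

lemma bary_in: "n \<ge> 1 \<Longrightarrow> x \<in> Delta n \<Longrightarrow> bary n x \<in> standard_simplex n"
proof (rule in_standard_simplexI)
  assume n: "n \<ge> 1" and x: "x \<in> Delta n"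
  show "0 \<le> bary n x j" "j > n \<Longrightarrow> bary n x j = 0" for j
    using x unfolding Delta_raw[OF n] by (auto simp: bary_def)
  have "x n = 0" using x unfolding Delta_raw[OF n] by auto
  then show "(\<Sum>j\<le>n. bary n x j) = 1"
    unfolding sum_atMost_split sum_bary[OF order_refl] by (simp add: bary_def)
qed

lemma unbary_bary: "n \<ge> 1 \<Longrightarrow> x \<in> Delta n \<Longrightarrow> unbary n (bary n x) = x"
  unfolding Delta_raw by (auto simp: unbary_def sum_bary fun_eq_iff simp del: One_nat_def)

lemma bary_unbary: 
  assumes "n \<ge> 1" and \<beta>: "\<beta> \<in> standard_simplex n"
  shows "bary n (unbary n \<beta>) = \<beta>"
proof
  fix j
  have m: "unbary n \<beta> (n - j) - unbary n \<beta> (n + 1 - j) = \<beta> j" if "j \<noteq> 0" "j \<le> n"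
    using that unbary_diff[of j n \<beta>] unbary_diff[of "j - 1" n \<beta>] by (cases j) auto
  have "unbary n \<beta> 0 = (\<Sum>j=1..n. \<beta> j)" using unbary_diff[of n n \<beta>] by simp
  then have "1 - unbary n \<beta> 0 = \<beta> 0" using simplexD(4)[OF \<beta>] unfolding sum_atMost_split by simp
  then show "bary n (unbary n \<beta>) j = \<beta> j" using m simplexD(3)[OF \<beta>] by (auto simp: bary_def)
qed

lemma unbary_in: 
  assumes "n \<ge> 1" and \<beta>: "\<beta> \<in> standard_simplex n"
  shows "unbary n \<beta> \<in> Delta n"
proof -
  have b: "0 \<le> bary n (unbary n \<beta>) j" for j using bary_unbary[OF assms] simplexD(1)[OF \<beta>] by simp
  have "unbary n \<beta> (n + 1 - r) \<le> unbary n \<beta> (n - r)" if "r \<in> {1..n}" for r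
    using b[of r] that by (simp add: bary_def)
  moreover have "unbary n \<beta> 0 \<le> 1" using b[of 0] by (simp add: bary_def)
  ultimately show ?thesis unfolding Delta_raw[OF assms(1)] by (auto simp: unbary_def)
qed

lemma continuous_on_bary: "continuous_on A (bary n)"
proof (rule continuous_on_coordinatewise_then_product)
  show "continuous_on A (\<lambda>x. bary n x i)" for i
    unfolding bary_def by (cases "i = 0"; cases "i \<le> n")
      (auto intro!: continuous_intros continuous_on_product_then_coordinatewise[OF continuous_on_id])
qed

lemma continuous_on_unbary: "continuous_on A (unbary n)"
proof (rule continuous_on_coordinatewise_then_product)
  show "continuous_on A (\<lambda>x. unbary n x i)" for i
    unfolding unbary_def by (cases "i < n")
      (auto intro!: continuous_intros continuous_on_product_then_coordinatewise[OF continuous_on_id])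
qed

text \<open>One computation for all four affine branches, which differ only in the first numerator
  \<open>z\<close> and the common denominator \<open>s\<close>. Here \<open>m\<close> is the smaller
  of the first two barycentric coordinates and \<open>s\<close> is the normalizing sum; the two
  conditions on \<open>z\<close> match barycentric coordinates 0 and \<open>n\<close>.\<close>

lemma bary_fold_map:
  assumes "folding n c" and x: "x \<in> Delta n"
    and y: "y = (\<lambda>i. if i < n then (if i = 0 then z else x (i - 1) - x (n - 1)) / s else 0)"
    and m: "m = min (1 - x 0) (x (n - 1))"
    and s: "s = 1 + (1 / c - 2) * m"
    and z: "z = s - \<bar>1 - x 0 - x (n - 1)\<bar>" "z - x 0 + x (n - 1) = m / c"
  shows "bary n y = fold_map n c (bary n x)"
proof
  interpret folding n c by (rule assms(1))
  let ?\<beta> = "bary n x"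
  have \<beta>: "?\<beta> \<in> standard_simplex n" by (rule bary_in[OF n x])
  have xn: "x i = 0" if "i \<ge> n" for i using x that unfolding Delta_raw[OF n] by auto
  have \<beta>01: "?\<beta> 0 = 1 - x 0" "?\<beta> 1 = x (n - 1)" using n xn by (auto simp: bary_def)
  have sum: "(\<Sum>j\<le>n. fold_raw n c ?\<beta> j) = s"
    unfolding sum_fold_raw[OF n] \<beta>01 simplexD(4)[OF \<beta>] s m ..
  have sp: "s > 0" using sum_fold_raw_pos[OF \<beta>] sum by simp
  \<comment> \<open>The formula persists at \<open>i = n\<close>, where its numerator is 0; this
    includes n = 1 in the case \<open>j = n\<close> below.\<close>
  have y': "y i = (if i = 0 then z else x (i - 1) - x (n - 1)) / s" if "i \<le> n" for i
    using that n unfolding y by (cases "i = n") auto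
  fix j
  have R: "fold_map n c ?\<beta> j = fold_raw n c ?\<beta> j / s" by (simp add: fold_map_def normalize_sum_def sum)
  consider "j = 0" | "j \<noteq> 0" "j < n" | "j = n" "j \<noteq> 0" | "j > n" by linarith
  then show "bary n y j = fold_map n c ?\<beta> j"
  proof cases
    case 1
    have "bary n y j = 1 - z / s" using 1 y'[of 0] by (simp add: bary_def)
    also have "\<dots> = (s - z) / s" using sp by (simp add: diff_divide_distrib)
    finally show ?thesis unfolding R using 1 z(1) \<beta>01 by (simp add: fold_raw_def)
  next
    case 2
    have "bary n y j = y (n - j) - y (n + 1 - j)" using 2 by (simp add: bary_def)
    also have "\<dots> = (x (n - j - 1) - x (n - 1)) / s - (x (n - j) - x (n - 1)) / s"
      using 2 y'[of "n - j"] y'[of "n + 1 - j"] by simp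
    also have "\<dots> = (x (n - Suc j) - x (n - j)) / s" by (simp add: diff_divide_distrib)
    also have "\<dots> = ?\<beta> (Suc j) / s" using 2 by (simp add: bary_def)
    finally show ?thesis unfolding R using 2 by (simp add: fold_raw_def)
  next
    case 3
    have "bary n y j = y 0 - y 1" using 3 by (simp add: bary_def)
    also have "\<dots> = (z - (x 0 - x (n - 1))) / s" using y'[of 0] y'[of 1] n by (simp add: diff_divide_distrib)
    also have "z - (x 0 - x (n - 1)) = m / c" using z(2) by simp
    finally show ?thesis unfolding R using 3 \<beta>01 m by (simp add: fold_raw_def)
  next
    case 4
    then show ?thesis unfolding R by (simp add: bary_def fold_raw_def)
  qed
qed

lemma bary_Moenkemeyer:
  assumes n: "n \<ge> 1" and x: "x \<in> Delta n"
  shows "bary n (Moenkemeyer n x) = fold_map n 1 (bary n x)"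
proof -
  have f: "folding n 1" using n by unfold_locales auto
  show ?thesis
  proof (cases "x 0 + x (n - 1) \<le> 1")
    case True
    then have "Moenkemeyer n x = M_branch n 0 x" using x n
      by (intro Moenkemeyer_on_part) (auto simp: Delta_part_eq simp del: One_nat_def)
    then show ?thesis using True
      by (intro bary_fold_map[OF f x, where z="x 0" and s="1 - x (n - 1)" and m="x (n - 1)"])
        (auto simp: M_branch_affine[OF n] simp del: One_nat_def)
  next
    case False
    then have "Moenkemeyer n x = M_branch n 1 x" using x n
      by (intro Moenkemeyer_on_part) (auto simp: Delta_part_eq simp del: One_nat_def)
    then show ?thesis using False
      by (intro bary_fold_map[OF f x, where z="1 - x (n - 1)" and s="x 0" and m="1 - x 0"])
        (auto simp: M_branch_affine[OF n] simp del: One_nat_def)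
  qed
qed

lemma bary_Tent:
  assumes n: "n \<ge> 1" and x: "x \<in> Delta n"
  shows "bary n (Tent n x) = fold_map n (1 / 2) (bary n x)"
proof -
  have f: "folding n (1 / 2)" using n by unfold_locales auto
  show ?thesis
  proof (cases "x 0 + x (n - 1) \<le> 1")
    case True
    then have "Tent n x = T_branch n 0 x" using x n
      by (intro Tent_on_part) (auto simp: Delta_part_eq simp del: One_nat_def)
    then show ?thesis using True
      by (intro bary_fold_map[OF f x, where z="x 0 + x (n - 1)" and s=1 and m="x (n - 1)"])
        (auto simp: T_branch_affine[OF n] simp del: One_nat_def)
  next
    case False
    then have "Tent n x = T_branch n 1 x" using x n
      by (intro Tent_on_part) (auto simp: Delta_part_eq simp del: One_nat_def)
    then show ?thesis using False
      by (intro bary_fold_map[OF f x, where z="2 - x 0 - x (n - 1)" and s=1 and m="1 - x 0"])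
        (auto simp: T_branch_affine[OF n] simp del: One_nat_def)
  qed
qed

lemma map_in_Delta:
  assumes n: "n \<ge> 1" and "\<forall>i\<ge>n. y i = 0" and "bary n y \<in> standard_simplex n"
  shows "y \<in> Delta n"
proof -
  have "unbary n (bary n y) = y"
    using assms(2) n by (auto simp: unbary_def sum_bary fun_eq_iff simp del: One_nat_def)
  then show ?thesis using unbary_in[OF n assms(3)] by simp
qed

lemma Moenkemeyer_in:
  assumes n: "n \<ge> 1" and x: "x \<in> Delta n"
  shows "Moenkemeyer n x \<in> Delta n"
proof (rule map_in_Delta[OF n])
  interpret folding n 1 using n by unfold_locales auto
  show "bary n (Moenkemeyer n x) \<in> standard_simplex n"
    unfolding bary_Moenkemeyer[OF n x] by (rule fold_map_in[OF bary_in[OF n x]])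
qed (simp add: Moenkemeyer_def M_branch_def proj_point_def)

lemma Tent_in:
  assumes n: "n \<ge> 1" and x: "x \<in> Delta n"
  shows "Tent n x \<in> Delta n"
proof (rule map_in_Delta[OF n])
  interpret folding n "1 / 2" using n by unfold_locales auto
  show "bary n (Tent n x) \<in> standard_simplex n"
    unfolding bary_Tent[OF n x] by (rule fold_map_in[OF bary_in[OF n x]])
qed (simp add: Tent_def T_branch_def)

lemma Delta_top_eq: "n \<ge> 1 \<Longrightarrow> Delta_top n = top_of_set (Delta n)"
  unfolding Delta_top_def Euclidean_space_def euclidean_product_topology subtopology_subtopology
  by (rule arg_cong[where f="subtopology euclidean"]) (auto simp: Delta_raw)

lemma homeomorphic_map_Delta_iff:
  assumes "n \<ge> 1"
  shows "homeomorphic_map (Delta_top n) (Delta_top n) f \<longleftrightarrow>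
    (\<exists>g. continuous_on (Delta n) f \<and> continuous_on (Delta n) g \<and>
      (\<forall>x\<in>Delta n. f x \<in> Delta n \<and> g x \<in> Delta n \<and> g (f x) = x \<and> f (g x) = x))"
  unfolding homeomorphic_map_maps homeomorphic_maps_def Delta_top_eq[OF assms] continuous_map_subtopology_eu
  by (auto simp: Pi_iff)

lemma conjugacy_iff:
  assumes n: "n \<ge> 1" and f: "\<And>x. x \<in> Delta n \<Longrightarrow> f x \<in> Delta n" "\<And>x. x \<in> Delta n \<Longrightarrow> g x \<in> Delta n"
    "\<And>x. x \<in> Delta n \<Longrightarrow> g (f x) = x" "\<And>x. x \<in> Delta n \<Longrightarrow> f (g x) = x"
  shows "(\<forall>x\<in>Delta n. Tent n x = (f \<circ> Moenkemeyer n \<circ> inv_into (Delta n) f) x) \<longleftrightarrow>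
    (\<forall>x\<in>Delta n. Tent n (f x) = f (Moenkemeyer n x))"
proof -
  have "inj_on f (Delta n)" by (metis f(3) inj_onI)
  then have inv: "inv_into (Delta n) f (f x) = x" if "x \<in> Delta n" for x using that by simp
  show ?thesis
  proof (intro iffI ballI)
    fix x assume "\<forall>x\<in>Delta n. Tent n x = (f \<circ> Moenkemeyer n \<circ> inv_into (Delta n) f) x" and x: "x \<in> Delta n"
    then show "Tent n (f x) = f (Moenkemeyer n x)" using f(1)[OF x] inv[OF x] by simp
  next
    fix x assume "\<forall>x\<in>Delta n. Tent n (f x) = f (Moenkemeyer n x)" and x: "x \<in> Delta n"
    then have "Tent n (f (g x)) = f (Moenkemeyer n (g x))" using f(2)[OF x] by blast
    moreover have "inv_into (Delta n) f x = g x" using inv[OF f(2)[OF x]] f(4)[OF x] by simp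
    ultimately show "Tent n x = (f \<circ> Moenkemeyer n \<circ> inv_into (Delta n) f) x" using f(4)[OF x] by simp
  qed
qed

lemma homeomorphic_conjugacy_iff:
  assumes n: "n \<ge> 1"
  shows "homeomorphic_map (Delta_top n) (Delta_top n) f \<and>
      (\<forall>x\<in>Delta n. Tent n x = (f \<circ> Moenkemeyer n \<circ> inv_into (Delta n) f) x) \<longleftrightarrow>
    (\<exists>g. (continuous_on (Delta n) f \<and> continuous_on (Delta n) g \<and>
      (\<forall>x\<in>Delta n. f x \<in> Delta n \<and> g x \<in> Delta n \<and> g (f x) = x \<and> f (g x) = x)) \<and>
      (\<forall>x\<in>Delta n. Tent n (f x) = f (Moenkemeyer n x)))"
proof -
  have "(\<forall>x\<in>Delta n. Tent n x = (f \<circ> Moenkemeyer n \<circ> inv_into (Delta n) f) x) \<longleftrightarrow>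
    (\<forall>x\<in>Delta n. Tent n (f x) = f (Moenkemeyer n x))"
    if "\<forall>x\<in>Delta n. f x \<in> Delta n \<and> g x \<in> Delta n \<and> g (f x) = x \<and> f (g x) = x" for g
    by (rule conjugacy_iff[OF n, where g=g]) (use that in auto)
  then show ?thesis unfolding homeomorphic_map_Delta_iff[OF n] by blast
qed

theorem theorem2p1:
  fixes n :: nat
  assumes "n \<ge> 1"
  shows "\<exists>!\<Phi>. \<Phi> \<in> extensional (Delta n) \<and>
           homeomorphic_map (Delta_top n) (Delta_top n) \<Phi> \<and>
           (\<forall>x\<in>Delta n. Tent n x = (\<Phi> \<circ> Moenkemeyer n \<circ> inv_into (Delta n) \<Phi>) x)"
proof (rule ex_ex1I)
  note n = assms
  let ?S = "standard_simplex n"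
  interpret MT: two_foldings n 1 "1 / 2" using n by unfold_locales auto
  interpret TM: two_foldings n "1 / 2" 1 by unfold_locales
  obtain f where f: "MT.semiconjugacy f" "MT.facet_preserving f" "continuous_on ?S f"
    by (rule MT.ex_semiconjugacy)
  obtain g where g: "TM.semiconjugacy g" "TM.facet_preserving g" "continuous_on ?S g"
    by (rule TM.ex_semiconjugacy)
  have gf: "g (f x) = x" if "x \<in> ?S" for x
    by (rule semiconjugacy_inverse[OF MT.two_foldings_axioms f(1,2) g(1,2) that])
  have fg: "f (g x) = x" if "x \<in> ?S" for x
    by (rule semiconjugacy_inverse[OF TM.two_foldings_axioms g(1,2) f(1,2) that])
  have fS: "f x \<in> ?S" and gS: "g x \<in> ?S" if "x \<in> ?S" for x
    using f(1) g(1) that unfolding MT.semiconjugacy_def TM.semiconjugacy_def by blast+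
  \<comment> \<open>Restriction assigns the default value outside the simplex, so that uniqueness
    can be stated for total functions.\<close>
  define F where "F = restrict (\<lambda>x. unbary n (f (bary n x))) (Delta n)"
  define G where "G = restrict (\<lambda>x. unbary n (g (bary n x))) (Delta n)"
  note b = bary_in[OF n] unbary_in[OF n] bary_unbary[OF n] unbary_bary[OF n]
  have FG: "F x \<in> Delta n" "G x \<in> Delta n" "G (F x) = x" "F (G x) = x" if "x \<in> Delta n" for x
    using that by (auto simp: F_def G_def b fS gS gf fg)
  have cont: "continuous_on (Delta n) (\<lambda>x. unbary n (k (bary n x)))" if "continuous_on ?S k" for k
    by (rule continuous_on_compose2[OF continuous_on_unbary[of UNIV]])
      (auto intro!: continuous_on_compose2[OF that continuous_on_bary] b)
  have "continuous_on (Delta n) F" "continuous_on (Delta n) G"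
    using cont[OF f(3)] cont[OF g(3)] by (auto simp: F_def G_def cong: continuous_on_cong)
  moreover have "\<forall>x\<in>Delta n. Tent n (F x) = F (Moenkemeyer n x)"
  proof
    fix x assume x: "x \<in> Delta n"
    have "bary n (Tent n (F x)) = f (fold_map n 1 (bary n x))"
      using bary_Tent[OF n FG(1)[OF x]] MT.semiconjugacy_commute[OF f(1) b(1)[OF x]] x
      by (simp add: F_def b fS)
    also have "\<dots> = bary n (F (Moenkemeyer n x))"
      using Moenkemeyer_in[OF n x] by (simp add: F_def b fS bary_Moenkemeyer[OF n x, symmetric])
    finally show "Tent n (F x) = F (Moenkemeyer n x)" using b(4) Tent_in[OF n FG(1)[OF x]] FG(1)[OF Moenkemeyer_in[OF n x]] by metis
  qed
  ultimately have "homeomorphic_map (Delta_top n) (Delta_top n) F \<and>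
      (\<forall>x\<in>Delta n. Tent n x = (F \<circ> Moenkemeyer n \<circ> inv_into (Delta n) F) x)"
    unfolding homeomorphic_conjugacy_iff[OF n] by (intro exI[of _ G]) (simp add: FG)
  moreover have "F \<in> extensional (Delta n)" unfolding F_def by (rule restrict_extensional)
  ultimately show "\<exists>\<Phi>. \<Phi> \<in> extensional (Delta n) \<and>
           homeomorphic_map (Delta_top n) (Delta_top n) \<Phi> \<and>
           (\<forall>x\<in>Delta n. Tent n x = (\<Phi> \<circ> Moenkemeyer n \<circ> inv_into (Delta n) \<Phi>) x)"
    by blast
next
  note n = assms
  let ?S = "standard_simplex n"
  note b = bary_in[OF n] unbary_in[OF n] bary_unbary[OF n] unbary_bary[OF n]
  fix F F'
  assume "F \<in> extensional (Delta n) \<and>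
           homeomorphic_map (Delta_top n) (Delta_top n) F \<and>
           (\<forall>x\<in>Delta n. Tent n x = (F \<circ> Moenkemeyer n \<circ> inv_into (Delta n) F) x)"
    and "F' \<in> extensional (Delta n) \<and>
           homeomorphic_map (Delta_top n) (Delta_top n) F' \<and>
           (\<forall>x\<in>Delta n. Tent n x = (F' \<circ> Moenkemeyer n \<circ> inv_into (Delta n) F') x)"
  note * = this[unfolded homeomorphic_conjugacy_iff[OF n]]
  from *(1) obtain G where ext: "F \<in> extensional (Delta n)"
    and F: "continuous_on (Delta n) F" "continuous_on (Delta n) G"
      "\<And>x. x \<in> Delta n \<Longrightarrow> F x \<in> Delta n" "\<And>x. x \<in> Delta n \<Longrightarrow> G x \<in> Delta n"
      "\<And>x. x \<in> Delta n \<Longrightarrow> G (F x) = x" "\<And>x. x \<in> Delta n \<Longrightarrow> F (G x) = x"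
    and TF: "\<And>x. x \<in> Delta n \<Longrightarrow> Tent n (F x) = F (Moenkemeyer n x)"
    by (elim conjE exE) blast
  from *(2) obtain G' where ext': "F' \<in> extensional (Delta n)"
    and F': "continuous_on (Delta n) F'" "continuous_on (Delta n) G'"
      "\<And>x. x \<in> Delta n \<Longrightarrow> F' x \<in> Delta n" "\<And>x. x \<in> Delta n \<Longrightarrow> G' x \<in> Delta n"
      "\<And>x. x \<in> Delta n \<Longrightarrow> G' (F' x) = x" "\<And>x. x \<in> Delta n \<Longrightarrow> F' (G' x) = x"
    and TF': "\<And>x. x \<in> Delta n \<Longrightarrow> Tent n (F' x) = F' (Moenkemeyer n x)"
    by (elim conjE exE) blast
  \<comment> \<open>If \<open>F\<close> and \<open>F'\<close> both conjugate the Moenkemeyer map to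
    the tent map, then \<open>F'\<close> after the inverse of \<open>F\<close> commutes with the
    tent map; \<open>h\<close> is this map in barycentric coordinates.\<close>
  define h where "h \<beta> = bary n (F' (G (unbary n \<beta>)))" for \<beta>
  define h' where "h' \<beta> = bary n (F (G' (unbary n \<beta>)))" for \<beta>
  have cont: "continuous_on ?S (\<lambda>\<beta>. bary n (K (L (unbary n \<beta>))))"
    if "continuous_on (Delta n) K" "continuous_on (Delta n) L" "\<And>x. x \<in> Delta n \<Longrightarrow> L x \<in> Delta n" for K L
    by (rule continuous_on_compose2[OF continuous_on_bary[of UNIV]])
      (auto intro!: continuous_on_compose2[OF that(1)] continuous_on_compose2[OF that(2) continuous_on_unbary] that(3) b)
  have cont_h: "continuous_on ?S h"
    unfolding h_def[abs_def] by (rule cont[OF F'(1) F(2,4)])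
  have cont_h': "continuous_on ?S h'"
    unfolding h'_def[abs_def] by (rule cont[OF F(1) F'(2,4)])
  interpret folding_automorphism n "1 / 2" h h'
  proof
    fix \<beta> assume \<beta>: "\<beta> \<in> ?S"
    let ?x = "unbary n \<beta>"
    have x: "?x \<in> Delta n" by (rule b(2)[OF \<beta>])
    have "fold_map n (1 / 2) (h \<beta>) = bary n (Tent n (F' (G ?x)))"
      unfolding h_def using bary_Tent[OF n] F'(3) F(4) x by simp
    also have "\<dots> = bary n (F' (Moenkemeyer n (G ?x)))" using TF' F(4) x by simp
    also have "Moenkemeyer n (G ?x) = G (Tent n ?x)"
      using TF[OF F(4)[OF x]] F(5)[OF Moenkemeyer_in[OF n F(4)[OF x]]] F(6)[OF x] by simp
    also have "Tent n ?x = unbary n (fold_map n (1 / 2) \<beta>)"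
      using bary_Tent[OF n x] b(3)[OF \<beta>] b(4)[OF Tent_in[OF n x]] by metis
    finally show "fold_map n (1 / 2) (h \<beta>) = h (fold_map n (1 / 2) \<beta>)" by (simp add: h_def)
  next
    show "continuous_on ?S h" by (fact cont_h)
    show "continuous_on ?S h'" by (fact cont_h')
  qed (use n in \<open>auto simp: h_def h'_def b F(3-6) F'(3-6)\<close>)
  have "F x = F' x" if x: "x \<in> Delta n" for x
  proof -
    have "h (bary n (F x)) = bary n (F x)" by (rule automorphism_trivial) (use x F b in auto)
    then have "bary n (F' x) = bary n (F x)" using x by (simp add: h_def b F)
    then show ?thesis using b(4) F(3) F'(3) x by metis
  qed
  then show "F = F'" by (rule extensionalityI[OF ext ext'])
qed

end
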